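(* Let $\mathcal G$ be a moral DAG with skeleton $G=(V,E)$, a finite graph, with parent function $\mathfrak{pa}$, and let $m$ be the number of connected components of $G$. 1) For $\alpha\in(0,\infty)^V$ and $\beta>0$, the normalizing constant $K_G(\alpha,\beta)=\left(\int_{M_G}\Delta_G(x)^{\beta-1}\prod_{i\in V}x_i^{\alpha_i-1}\,dx\right)^{-1}$ is given by $$K_G(\alpha,\beta)=\prod_{i\in V}\frac{\Gamma(|\alpha_{\overline{\mathfrak{pa}}(i)}|+\beta)}{\Gamma(|\alpha_{\mathfrak{pa}(i)}|+\beta)\,\Gamma(\alpha_i)}=\frac{\prod_{C\in\mathcal C_G^+}\Gamma(|\alpha_C|+\beta)}{\Gamma(\beta)^m\prod_{i\in V}\Gamma(\alpha_i)\prod_{S\in\mathcal S_G^-}\left(\Gamma(|\alpha_S|+\beta)\right)^{\nu_S}}.$$ 2) For $\alpha\in(0,\infty)^V$ and $\beta>\max_{C\in\mathcal C_G^+}|\alpha_C|$, the normalizing constant $k_G(\alpha,\beta)=\left(\int_{(0,\infty)^V}\delta_G(y)^{-\beta}\prod_{i\in V}y_i^{\alpha_i-1}\,dy\right)^{-1}$ is given by $$k_G(\alpha,\beta)=\prod_{i\in V}\frac{\Gamma(\beta-|\alpha_{\mathfrak{pa}(i)}|)}{\Gamma(\beta-|\alpha_{\overline{\mathfrak{pa}}(i)}|)\,\Gamma(\alpha_i)}=\frac{\Gamma(\beta)^m\prod_{S\in\mathcal S_G^-}\left(\Gamma(\beta-|\alpha_S|)\right)^{\nu_S}}{\prod_{i\in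 V}\Gamma(\alpha_i)\prod_{C\in\mathcal C_G^+}\Gamma(\beta-|\alpha_C|)}.$$
   Context: $G=(V,E)$ is a finite undirected simple graph; $G^*$ its complement graph; $G_A$ the subgraph induced by $A\subset V$. A clique is a set of pairwise adjacent vertices ($\emptyset$ and singletons are cliques); $\mathcal C_{G}$ is the set of cliques and $\mathcal C_G^+$ the set of maximal cliques of $G$. A moral DAG $\mathcal G$ with skeleton $G$ is an orientation of all edges of $G$ without directed cycles such that any two distinct parents of a common vertex are adjacent (then $G$ is decomposable, i.e. chordal; it may be disconnected). $\mathfrak{pa}(i)=\{j:j\to i\}$, $\overline{\mathfrak{pa}}(i)=\mathfrak{pa}(i)\cup\{i\}$. Minimal separators: the maximal cliques of a decomposable graph admit a perfect ordering $C_1,\ldots,C_K$, i.e. for each $k\ge2$ there is $\ell<k$ with $S_k:=C_k\cap(C_1\cup\cdots\cup C_{k-1})\subset C_\ell$. $\mathcal S_G^-$ is the set of nonempty sets occurring among $S_2,\ldots,S_K$, and $\nu_S$ is the number of $k$ with $S_k=S$; these do not depend on the perfect ordering. $\Delta_G(x)=\sum_{C\in\mathcal C_{G^*}}(-1)^{|C|}\prod_{i\in C}x_i$, $\delta_G(y)=\sum_{C\in\mathcal C_{G^*}}\prod_{i\in C}y_i$; $\Delta_A(x):=\Delta_{G_A}(x_A)$ with $x_A=(x_i)_{i\in A}$, $\Delta_\emptyset=1$; $M_G=\{x\in(0,\infty)^V:\Delta_A(x)>0\ \forall A\subset V\}$. $|\alpha_A|=\sum_{i\in A}\alpha_i$.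 $\Gamma$ is the Euler gamma function. ($K_G$ and $k_G$ are the normalizing constants of the $G$-Dirichlet and $G$-inverted Dirichlet densities, proportional to $\Delta_G(x)^{\beta-1}x^{\alpha-1}\mathbf 1_{M_G}(x)$ and $\delta_G(y)^{-\beta}y^{\alpha-1}\mathbf 1_{(0,\infty)^V}(y)$.) *)

theory Defs
  imports "HOL-Analysis.Analysis" "Graph_Theory.Graph_Theory"
begin

text \<open>
  Finite undirected simple graphs are the loop-free symmetric finite digraphs
  of the locale \<^locale>\<open>pair_graph\<close>: an edge between \<open>u\<close> and \<open>v\<close> is present as both
  arcs \<open>(u, v)\<close> and \<open>(v, u)\<close>.  Consequently the strongly connected components \<open>sccs\<close> of
  such a graph are its connected components, and \<open>G \<restriction> A\<close> is the subgraph induced by \<open>A\<close>.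
\<close>

definition complement_graph :: "('v, 'e) pre_digraph \<Rightarrow> 'v pair_pre_digraph" where
  "complement_graph G =
     \<lparr>pverts = verts G,
      parcs = {(u, v). u \<in> verts G \<and> v \<in> verts G \<and> u \<noteq> v \<and> (u, v) \<notin> arcs_ends G}\<rparr>"

definition cliques :: "('v, 'e) pre_digraph \<Rightarrow> 'v set set" where
  "cliques G = {C. C \<subseteq> verts G \<and> (\<forall>u\<in>C. \<forall>v\<in>C. u \<noteq> v \<longrightarrow> (u, v) \<in> arcs_ends G)}"

definition max_cliques :: "('v, 'e) pre_digraph \<Rightarrow> 'v set set" where
  "max_cliques G = {C \<in> cliques G. \<forall>C'\<in>cliques G. C \<subseteq> C' \<longrightarrow> C' = C}"

definition num_components :: "('v, 'e) pre_digraph \<Rightarrow> nat" where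
  "num_components G = card (pre_digraph.sccs G)"

definition parents :: "'v pair_pre_digraph \<Rightarrow> 'v \<Rightarrow> 'v set" where
  "parents D i = {j. (j, i) \<in> parcs D}"

definition closed_parents :: "'v pair_pre_digraph \<Rightarrow> 'v \<Rightarrow> 'v set" where
  "closed_parents D i = insert i (parents D i)"

text \<open>
  Acyclicity excludes opposite arcs, so a moral DAG orients every edge of its skeleton
  \<open>mk_symmetric D\<close> in exactly one direction.
\<close>

definition moral_dag :: "'v pair_pre_digraph \<Rightarrow> bool" where
  "moral_dag D \<longleftrightarrow> pair_digraph D \<and> acyclic (parcs D) \<and>
     (\<forall>i. \<forall>j\<in>parents D i. \<forall>k\<in>parents D i. j \<noteq> k \<longrightarrow> (j, k) \<in> parcs D \<or> (k, j) \<in> parcs D)"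

text \<open>
  The list \<open>Cs\<close> enumerates \<open>C\<^sub>1, \<dots>, C\<^sub>K\<close> with indices shifted to start at \<open>0\<close>, so that
  \<open>sep Cs k\<close> is meaningful for \<open>1 \<le> k < K\<close>.
\<close>

definition sep :: "'v set list \<Rightarrow> nat \<Rightarrow> 'v set" where
  "sep Cs k = Cs ! k \<inter> (\<Union>l<k. Cs ! l)"

definition perfect_ordering :: "('v, 'e) pre_digraph \<Rightarrow> 'v set list \<Rightarrow> bool" where
  "perfect_ordering G Cs \<longleftrightarrow> distinct Cs \<and> set Cs = max_cliques G \<and>
     (\<forall>k\<in>{1..<length Cs}. \<exists>l<k. sep Cs k \<subseteq> Cs ! l)"

definition min_separators :: "'v set list \<Rightarrow> 'v set set" where
  "min_separators Cs = sep Cs ` {1..<length Cs} - {{}}"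

definition sep_multiplicity :: "'v set list \<Rightarrow> 'v set \<Rightarrow> nat" where
  "sep_multiplicity Cs S = card {k \<in> {1..<length Cs}. sep Cs k = S}"

text \<open>
  These polynomials only involve the coordinates in \<open>verts G\<close>; in particular
  \<open>\<Delta> (G \<restriction> A) x\<close> needs no explicit restriction of \<open>x\<close> to \<open>A\<close>.
\<close>

definition \<Delta> :: "('v, 'e) pre_digraph \<Rightarrow> ('v \<Rightarrow> real) \<Rightarrow> real" where
  "\<Delta> G x = (\<Sum>C\<in>cliques (complement_graph G). (- 1) ^ card C * (\<Prod>i\<in>C. x i))"

definition \<delta> :: "('v, 'e) pre_digraph \<Rightarrow> ('v \<Rightarrow> real) \<Rightarrow> real" where
  "\<delta> G y = (\<Sum>C\<in>cliques (complement_graph G). \<Prod>i\<in>C. y i)"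

text \<open>
  Vectors indexed by a finite set \<open>V\<close> are extensional functions, and \<open>lebesgue_on_vectors V\<close>
  is Lebesgue measure on them.
\<close>

abbreviation lebesgue_on_vectors :: "'v set \<Rightarrow> ('v \<Rightarrow> real) measure" where
  "lebesgue_on_vectors V \<equiv> Pi\<^sub>M V (\<lambda>_. lborel)"

definition pos_orthant :: "'v set \<Rightarrow> ('v \<Rightarrow> real) set" where
  "pos_orthant V = (\<Pi>\<^sub>E i\<in>V. {0<..})"

definition M_dom :: "('v, 'e) pre_digraph \<Rightarrow> ('v \<Rightarrow> real) set" where
  "M_dom G = {x \<in> pos_orthant (verts G). \<forall>A\<subseteq>verts G. \<Delta> (G \<restriction> A) x > 0}"

definition dirichlet_kernel ::
    "('v, 'e) pre_digraph \<Rightarrow> ('v \<Rightarrow> real) \<Rightarrow> real \<Rightarrow> ('v \<Rightarrow> real) \<Rightarrow> real" where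
  "dirichlet_kernel G \<alpha> \<beta> x = \<Delta> G x powr (\<beta> - 1) * (\<Prod>i\<in>verts G. x i powr (\<alpha> i - 1))"

definition inv_dirichlet_kernel ::
    "('v, 'e) pre_digraph \<Rightarrow> ('v \<Rightarrow> real) \<Rightarrow> real \<Rightarrow> ('v \<Rightarrow> real) \<Rightarrow> real" where
  "inv_dirichlet_kernel G \<alpha> \<beta> y = \<delta> G y powr (- \<beta>) * (\<Prod>i\<in>verts G. y i powr (\<alpha> i - 1))"

definition dirichlet_const :: "('v, 'e) pre_digraph \<Rightarrow> ('v \<Rightarrow> real) \<Rightarrow> real \<Rightarrow> real" where
  "dirichlet_const G \<alpha> \<beta> =
     inverse (LINT x:M_dom G|lebesgue_on_vectors (verts G). dirichlet_kernel G \<alpha> \<beta> x)"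

definition inv_dirichlet_const :: "('v, 'e) pre_digraph \<Rightarrow> ('v \<Rightarrow> real) \<Rightarrow> real \<Rightarrow> real" where
  "inv_dirichlet_const G \<alpha> \<beta> =
     inverse (LINT y:pos_orthant (verts G)|lebesgue_on_vectors (verts G).
       inv_dirichlet_kernel G \<alpha> \<beta> y)"

end

theory Submission
  imports Defs
begin

text \<open>
  Let \<open>v\<close> be a sink of the moral DAG.  Its neighbours are its parents, and these form a clique
  \<open>P\<close>.  The polynomial \<open>\<Delta>\<^sub>G(x)\<close> is the independence polynomial of \<open>G\<close> at \<open>-x\<close>; an independent
  set contains at most one vertex of a clique, so the polynomial is affine in the coordinates of
  \<open>P\<close> jointly, and the substitution \<open>x\<^sub>v = u\<close>, \<open>x\<^sub>p = (1 - u) x'\<^sub>p\<close> for \<open>p \<in> P\<close> factors it as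
  \<open>\<Delta>\<^sub>G(x) = (1 - u) \<Delta>\<^sub>G\<^sub>-\<^sub>v(x')\<close>.  The same holds for all induced subgraphs, hence the
  substitution maps \<open>(0, 1) \<times> M\<^sub>G\<^sub>-\<^sub>v\<close> onto \<open>M\<^sub>G\<close> (\<open>M_dom_insert_sink\<close>).  With the Jacobian
  \<open>(1 - u) ^ card P\<close> the integral splits into a Beta integral in \<open>u\<close> and the integral of the same kernel
  over \<open>M\<^sub>G\<^sub>-\<^sub>v\<close> with the same parameters.  Removing sinks one after the other therefore gives a product
  of Beta functions, one for each vertex: this is stick breaking along the DAG.  As
  \<open>\<delta>\<^sub>G(y) = \<Delta>\<^sub>G(-y)\<close>, the same substitution with \<open>u = -t\<close> treats the inverted integral and leaves
  Beta integrals of the second kind.  The induction runs over the vertex sets that are closed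
  under parents (\<open>ancestral_induct\<close>).

  The second form of the constants is a purely combinatorial rewriting of the first, valid for every
  function \<open>g\<close> of vertex sets in the place of the Gamma factors.  It rests on an identity of
  multisets of vertex sets: the closed parent sets together with the separators are the parent
  sets together with the maximal cliques (\<open>parents_separators_multiset\<close>).  A finite multiset of
  sets is determined by the number of its members above each set \<open>T\<close>, and both sides have the same
  counts since a nonempty clique \<open>T\<close> has exactly one last vertex in the DAG, and exactly one maximal
  clique in a perfect ordering that contains it first.  The members that are empty show that the
  number of empty separators, where the first maximal clique is given an empty one, is the number of
  sources of the DAG.  By morality every vertex has only one source as an ancestor, so that the
  sources represent the connected components; this is the exponent of \<open>\<Gamma>(\<beta>)\<close>.
\<close>

section \<open>Splitting one coordinate off a product integral\<close>

text \<open>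
  The diagonal case of the linear change of variables, for Lebesgue measure on extensional
  functions, whose index set is not a Euclidean space type.
\<close>

lemma nn_integral_PiM_scale:
  fixes c :: "'v \<Rightarrow> real"
  assumes "finite I" and "f \<in> borel_measurable (lebesgue_on_vectors I)" and "\<And>i. i \<in> I \<Longrightarrow> c i > 0"
  shows "(\<integral>\<^sup>+x. f x \<partial>lebesgue_on_vectors I) =
    ennreal (\<Prod>i\<in>I. c i) * (\<integral>\<^sup>+x. f (\<lambda>i\<in>I. c i * x i) \<partial>lebesgue_on_vectors I)"
  using assms
proof (induction I arbitrary: f rule: finite_induct)
  case empty
  interpret product_sigma_finite "\<lambda>_::'v. lborel :: real measure" ..
  show ?case by (simp add: nn_integral_empty space_PiM)
next
  case (insert i I)
  interpret product_sigma_finite "\<lambda>_::'v. lborel :: real measure" ..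
  note [measurable] = insert.prems(1)
  have [simp]: "(\<Prod>i\<in>I. c i) \<ge> 0" using insert.prems(2) by (intro prod_nonneg) (auto intro: less_imp_le)
  have ci: "c i > 0" using insert.prems by auto
  have [measurable]: "(\<lambda>y. x(i := y)) \<in> lborel \<rightarrow>\<^sub>M lebesgue_on_vectors (insert i I)"
    if "x \<in> space (lebesgue_on_vectors I)" for x :: "'v \<Rightarrow> real"
    using that by (rule measurable_component_update) (use insert.hyps in auto)
  have [measurable]: "(\<lambda>y. f (x(i := y))) \<in> borel_measurable lborel"
    if "x \<in> space (lebesgue_on_vectors I)" for x
    using that by measurable
  have upd: "(\<lambda>j\<in>insert i I. c j * (x(i := y)) j) = (\<lambda>j\<in>I. c j * x j)(i := c i * y)" for x y
    using insert.hyps by (auto simp: fun_eq_iff)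
  have m: "(\<lambda>x. f (\<lambda>j\<in>insert i I. c j * x j)) \<in> borel_measurable (lebesgue_on_vectors (insert i I))"
    by measurable
  have "(\<integral>\<^sup>+x. f x \<partial>lebesgue_on_vectors (insert i I)) =
     (\<integral>\<^sup>+x. (\<integral>\<^sup>+y. f (x(i := y)) \<partial>lborel) \<partial>lebesgue_on_vectors I)"
    by (intro product_nn_integral_insert insert)
  also have "\<dots> = (\<integral>\<^sup>+x. ennreal (c i) * (\<integral>\<^sup>+y. f (x(i := c i * y)) \<partial>lborel) \<partial>lebesgue_on_vectors I)"
    using ci
    by (intro nn_integral_cong, subst nn_integral_real_affine[where c = "c i" and t = 0]) auto
  also have "\<dots> = ennreal (\<Prod>i\<in>I. c i) * (\<integral>\<^sup>+x. ennreal (c i) * (\<integral>\<^sup>+y. f ((\<lambda>j\<in>I. c j * x j)(i := c i * y)) \<partial>lborel) \<partial>lebesgue_on_vectors I)"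
  proof (intro insert.IH)
    have "(\<lambda>p. f ((\<lambda>(x, y). x(i := y)) (fst p, c i * snd p))) \<in> borel_measurable (lebesgue_on_vectors I \<Otimes>\<^sub>M lborel)"
      using measurable_add_dim[of i I "\<lambda>_::'v. lborel :: real measure"] by measurable
    then have "case_prod (\<lambda>x y. f (x(i := c i * y))) \<in> borel_measurable (lebesgue_on_vectors I \<Otimes>\<^sub>M lborel)"
      by (simp add: case_prod_beta')
    from lborel.borel_measurable_nn_integral[OF this]
    show "(\<lambda>x. ennreal (c i) * (\<integral>\<^sup>+y. f (x(i := c i * y)) \<partial>lborel)) \<in> borel_measurable (lebesgue_on_vectors I)"
      by measurable
  qed (use insert.prems in auto)
  also have "\<dots> = ennreal (\<Prod>i\<in>insert i I. c i) * (\<integral>\<^sup>+x. (\<integral>\<^sup>+y. f ((\<lambda>j\<in>I. c j * x j)(i := c i * y)) \<partial>lborel) \<partial>lebesgue_on_vectors I)"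
  proof -
    have "(\<lambda>x. \<integral>\<^sup>+y. f ((\<lambda>j\<in>I. c j * x j)(i := c i * y)) \<partial>lborel) \<in> borel_measurable (lebesgue_on_vectors I)"
      unfolding upd[symmetric] by measurable
    then show ?thesis
      using insert.hyps ci by (simp add: nn_integral_cmult ennreal_mult ac_simps)
  qed
  also have "(\<integral>\<^sup>+x. (\<integral>\<^sup>+y. f ((\<lambda>j\<in>I. c j * x j)(i := c i * y)) \<partial>lborel) \<partial>lebesgue_on_vectors I) =
     (\<integral>\<^sup>+x. f (\<lambda>i\<in>insert i I. c i * x i) \<partial>lebesgue_on_vectors (insert i I))"
    unfolding product_nn_integral_insert[OF insert.hyps(1,2) m] upd ..
  finally show ?case .
qed

definition scale_on :: "'v set \<Rightarrow> 'v set \<Rightarrow> real \<Rightarrow> ('v \<Rightarrow> real) \<Rightarrow> 'v \<Rightarrow> real" where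
  "scale_on W P c x = (\<lambda>i\<in>W. (if i \<in> P then c else 1) * x i)"

text \<open>
  The change of variables shared by both integrals: for a fixed value \<open>u\<close> of the new coordinate, the
  coordinates in \<open>P\<close> are scaled by \<open>c u\<close>, with Jacobian \<open>c u ^ card P\<close>, and the integrand is supposed
  to become a product in these variables.
\<close>

lemma nn_integral_split_coordinate:
  fixes f g :: "('v \<Rightarrow> real) \<Rightarrow> ennreal" and c :: "real \<Rightarrow> real"
  assumes fin: "finite W" "v \<notin> W" "P \<subseteq> W"
    and f [measurable]: "f \<in> borel_measurable (lebesgue_on_vectors (insert v W))"
    and g [measurable]: "g \<in> borel_measurable (lebesgue_on_vectors W)"
    and h [measurable]: "h \<in> borel_measurable borel"
    and c: "\<And>u. u \<in> U \<Longrightarrow> c u > 0"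
    and in_U: "\<And>u x. u \<in> U \<Longrightarrow> x \<in> space (lebesgue_on_vectors W) \<Longrightarrow>
      ennreal (c u ^ card P) * f ((scale_on W P (c u) x)(v := u)) = h u * g x"
    and off_U: "\<And>u x. u \<notin> U \<Longrightarrow> f (x(v := u)) = 0" "\<And>u. u \<notin> U \<Longrightarrow> h u = 0"
  shows "(\<integral>\<^sup>+x. f x \<partial>lebesgue_on_vectors (insert v W)) =
    (\<integral>\<^sup>+u. h u \<partial>lborel) * (\<integral>\<^sup>+x. g x \<partial>lebesgue_on_vectors W)"
proof -
  interpret product_sigma_finite "\<lambda>_::'v. lborel :: real measure" ..
  have inner: "(\<integral>\<^sup>+x. f (x(v := u)) \<partial>lebesgue_on_vectors W) =
      h u * (\<integral>\<^sup>+x. g x \<partial>lebesgue_on_vectors W)" for u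
  proof (cases "u \<in> U")
    case True
    have [measurable]: "(\<lambda>x. x(v := u)) \<in> lebesgue_on_vectors W \<rightarrow>\<^sub>M lebesgue_on_vectors (insert v W)"
      by (rule measurable_fun_upd[where J=W]) auto
    have [measurable]: "scale_on W P (c u) \<in> lebesgue_on_vectors W \<rightarrow>\<^sub>M lebesgue_on_vectors W"
      unfolding scale_on_def by measurable
    have prod: "(\<Prod>i\<in>W. if i \<in> P then c u else 1) = c u ^ card P"
      using fin by (simp add: prod.If_cases Int_absorb1)
    have "(\<integral>\<^sup>+x. f (x(v := u)) \<partial>lebesgue_on_vectors W) =
        ennreal (c u ^ card P) * (\<integral>\<^sup>+x. f ((scale_on W P (c u) x)(v := u)) \<partial>lebesgue_on_vectors W)"
      unfolding prod[symmetric] scale_on_def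
      by (rule nn_integral_PiM_scale) (use fin c[OF True] in auto)
    also have "\<dots> = (\<integral>\<^sup>+x. ennreal (c u ^ card P) * f ((scale_on W P (c u) x)(v := u)) \<partial>lebesgue_on_vectors W)"
      by (rule nn_integral_cmult[symmetric]) measurable
    also have "\<dots> = (\<integral>\<^sup>+x. h u * g x \<partial>lebesgue_on_vectors W)"
      using in_U[OF True] by (intro nn_integral_cong) auto
    also have "\<dots> = h u * (\<integral>\<^sup>+x. g x \<partial>lebesgue_on_vectors W)"
      by (rule nn_integral_cmult) measurable
    finally show ?thesis .
  qed (simp add: off_U)
  show ?thesis
    using fin(1,2) by (simp add: product_nn_integral_insert_rev inner nn_integral_multc)
qed

section \<open>Beta integrals of both kinds\<close>

lemma Beta_real_pos:
  fixes a b :: real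
  shows "a > 0 \<Longrightarrow> b > 0 \<Longrightarrow> Beta a b > 0"
  by (simp add: Beta_def)

lemma nn_integral_Beta:
  fixes a b :: real
  assumes "a > 0" "b > 0"
  shows "(\<integral>\<^sup>+u. ennreal (u powr (a - 1) * (1 - u) powr (b - 1)) * indicator {0<..<1} u \<partial>lborel) = ennreal (Beta a b)"
proof -
  have "((\<lambda>t. t powr (a - 1) * (1 - t) powr (b - 1)) has_integral Beta a b) {0<..<1}"
    using has_integral_Beta_real[OF assms] by (simp add: has_integral_Icc_iff_Ioo)
  from nn_integral_has_integral_lebesgue'[OF _ this] show ?thesis by simp
qed

lemma nn_integral_Gamma_scaled:
  fixes a s :: real
  assumes "a > 0" "s > 0"
  shows "(\<integral>\<^sup>+t. ennreal (t powr (a - 1) * exp (- (s * t))) * indicator {0<..} t \<partial>lborel) =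
    ennreal (Gamma a * s powr (- a))"
proof -
  let ?g = "\<lambda>t. ennreal (t powr (a - 1) * exp (- t)) * indicator {0<..} t"
  have sub: "?g (0 + s * t) = ennreal (s powr (a - 1)) * (ennreal (t powr (a - 1) * exp (- (s * t))) * indicator {0<..} t)" for t
    using \<open>s > 0\<close> by (auto simp: indicator_def zero_less_mult_iff powr_mult ennreal_mult'[symmetric] ac_simps)
  have "ennreal (Gamma a) = (\<integral>\<^sup>+t. ?g t \<partial>lborel)"
    unfolding Gamma_conv_nn_integral_real[OF \<open>a > 0\<close>]
    by (intro nn_integral_cong) (auto simp: indicator_def exp_minus divide_simps)
  also have "\<dots> = ennreal s * (\<integral>\<^sup>+t. ?g (0 + s * t) \<partial>lborel)"
    using \<open>s > 0\<close> by (subst nn_integral_real_affine[where c = s and t = 0]) auto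
  also have "\<dots> = ennreal (s powr a) * (\<integral>\<^sup>+t. ennreal (t powr (a - 1) * exp (- (s * t))) * indicator {0<..} t \<partial>lborel)"
    unfolding sub using \<open>s > 0\<close>
    by (subst nn_integral_cmult) (auto simp: mult.assoc[symmetric] ennreal_mult'[symmetric] powr_mult_base)
  finally have "ennreal (s powr (- a)) * ennreal (Gamma a) = ennreal (s powr (- a)) * ennreal (s powr a) * (\<integral>\<^sup>+t. ennreal (t powr (a - 1) * exp (- (s * t))) * indicator {0<..} t \<partial>lborel)"
    by (simp add: mult.assoc)
  then show ?thesis using \<open>s > 0\<close> by (simp add: ennreal_mult[symmetric] ennreal_mult'[symmetric] powr_add[symmetric] mult.commute Gamma_real_pos less_imp_le[OF Gamma_real_pos[OF \<open>a > 0\<close>]])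
qed

text \<open>
  Evaluate the double integral of \<open>t powr (a - 1) * r powr (a + b - 1) * exp (- ((1 + t) * r))\<close> in
  both orders: the \<open>r\<close>-integral gives \<open>\<Gamma>(a + b)\<close> times the integrand of the claim, the
  \<open>t\<close>-integral gives \<open>\<Gamma>(a)\<close> times the integrand of \<open>\<Gamma>(b)\<close>.
\<close>

lemma nn_integral_Beta_prime:
  fixes a b :: real
  assumes a: "a > 0" and b: "b > 0"
  shows "(\<integral>\<^sup>+t. ennreal (t powr (a - 1) * (1 + t) powr (- (a + b))) * indicator {0<..} t \<partial>lborel) = ennreal (Beta a b)"
    (is "?J = _")
proof -
  let ?f = "\<lambda>t r. ennreal (t powr (a - 1) * r powr (a + b - 1) * exp (- ((1 + t) * r))) * indicator {0<..} t * indicator {0<..} r"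
  have pos: "Gamma (a + b) > 0" "Gamma a > 0" "Gamma b > 0" using a b by auto
  have inner_r: "(\<integral>\<^sup>+r. ?f t r \<partial>lborel) = ennreal (Gamma (a + b)) * (ennreal (t powr (a - 1) * (1 + t) powr (- (a + b))) * indicator {0<..} t)" for t
  proof (cases "t > 0")
    case True
    have "(\<integral>\<^sup>+r. ?f t r \<partial>lborel) = (\<integral>\<^sup>+r. ennreal (t powr (a - 1)) * (ennreal (r powr (a + b - 1) * exp (- ((1 + t) * r))) * indicator {0<..} r) \<partial>lborel)"
      using True by (intro nn_integral_cong) (auto simp: ennreal_mult'[symmetric] indicator_def ac_simps)
    also have "\<dots> = ennreal (t powr (a - 1)) * ennreal (Gamma (a + b) * (1 + t) powr (- (a + b)))"
      using True a b by (subst nn_integral_cmult) (auto simp: nn_integral_Gamma_scaled)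
    finally show ?thesis using True pos by (simp add: ennreal_mult'[symmetric] ac_simps)
  qed auto
  have inner_t: "(\<integral>\<^sup>+t. ?f t r \<partial>lborel) = ennreal (Gamma a) * (ennreal (r powr (b - 1) * exp (- (1 * r))) * indicator {0<..} r)" for r
  proof (cases "r > 0")
    case True
    have "(\<integral>\<^sup>+t. ?f t r \<partial>lborel) = (\<integral>\<^sup>+t. ennreal (r powr (a + b - 1) * exp (- r)) * (ennreal (t powr (a - 1) * exp (- (r * t))) * indicator {0<..} t) \<partial>lborel)"
      using True by (intro nn_integral_cong)
        (auto simp: ennreal_mult'[symmetric] indicator_def exp_add[symmetric] algebra_simps)
    also have "\<dots> = ennreal (r powr (a + b - 1) * exp (- r)) * ennreal (Gamma a * r powr (- a))"
      using True a by (subst nn_integral_cmult) (auto simp: nn_integral_Gamma_scaled)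
    also have "\<dots> = ennreal (Gamma a * ((r powr (a + b - 1) * r powr (- a)) * exp (- r)))"
      using True pos by (simp add: ennreal_mult'[symmetric] ac_simps)
    also have "r powr (a + b - 1) * r powr (- a) = r powr (b - 1)"
      using True by (simp add: powr_add[symmetric])
    finally show ?thesis using True pos by (simp add: ennreal_mult'[symmetric] ac_simps)
  qed auto
  have "ennreal (Gamma (a + b)) * ?J = (\<integral>\<^sup>+t. \<integral>\<^sup>+r. ?f t r \<partial>lborel \<partial>lborel)"
    unfolding inner_r by (rule nn_integral_cmult[symmetric]) measurable
  also have "\<dots> = (\<integral>\<^sup>+r. \<integral>\<^sup>+t. ?f t r \<partial>lborel \<partial>lborel)"
    by (rule lborel_pair.Fubini') measurable
  also have "\<dots> = ennreal (Gamma a) * (\<integral>\<^sup>+r. ennreal (r powr (b - 1) * exp (- (1 * r))) * indicator {0<..} r \<partial>lborel)"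
    unfolding inner_t by (rule nn_integral_cmult) measurable
  also have "\<dots> = ennreal (Gamma a) * ennreal (Gamma b)"
    using b by (subst nn_integral_Gamma_scaled) auto
  also have "\<dots> = ennreal (Gamma (a + b)) * ennreal (Beta a b)"
    using pos by (simp add: Beta_def ennreal_mult'[symmetric])
  finally show ?thesis
    using pos by (simp add: ennreal_mult_cancel_left)
qed

section \<open>Independence polynomials\<close>

definition independent_sets :: "'v rel \<Rightarrow> 'v set \<Rightarrow> 'v set set" where
  "independent_sets E A = {S. S \<subseteq> A \<and> (\<forall>u\<in>S. \<forall>v\<in>S. u \<noteq> v \<longrightarrow> (u, v) \<notin> E)}"

definition indep_poly :: "'v rel \<Rightarrow> 'v set \<Rightarrow> ('v \<Rightarrow> real) \<Rightarrow> real" where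
  "indep_poly E A x = (\<Sum>S\<in>independent_sets E A. \<Prod>i\<in>S. x i)"

lemma finite_independent_sets: "finite A \<Longrightarrow> finite (independent_sets E A)"
  by (rule finite_subset[of _ "Pow A"]) (auto simp: independent_sets_def)

lemma indep_poly_empty [simp]: "indep_poly E {} x = 1"
proof -
  have "independent_sets E {} = {{}}" by (auto simp: independent_sets_def)
  then show ?thesis by (simp add: indep_poly_def)
qed

lemma indep_poly_cong:
  assumes "\<And>i. i \<in> A \<Longrightarrow> x i = y i"
  shows "indep_poly E A x = indep_poly E A y"
  unfolding indep_poly_def using assms
  by (intro sum.cong prod.cong refl) (auto simp: independent_sets_def)

text \<open>
  Sort the independent sets by whether they contain \<open>v\<close>; those that do consist of \<open>v\<close> and an
  independent set outside its closed neighbourhood.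
\<close>

lemma indep_poly_remove:
  assumes "finite A" "sym E" "v \<in> A"
  shows "indep_poly E A x = indep_poly E (A - {v}) x + x v * indep_poly E (A - insert v (E `` {v})) x"
proof -
  let ?N = "independent_sets E (A - insert v (E `` {v}))"
  have eq: "independent_sets E A = independent_sets E (A - {v}) \<union> insert v ` ?N"
  proof safe
    fix S assume S: "S \<in> independent_sets E A" "S \<notin> insert v ` ?N"
    show "S \<in> independent_sets E (A - {v})"
    proof (cases "v \<in> S")
      case True
      then have "S - {v} \<in> ?N" "S = insert v (S - {v})"
        using S(1) by (auto simp: independent_sets_def)
      then show ?thesis using S(2) by blast
    qed (use S in \<open>auto simp: independent_sets_def\<close>)
  qed (use assms in \<open>auto simp: independent_sets_def dest: symD\<close>)
  have inj: "inj_on (insert v) ?N"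
    by (rule inj_onI) (auto simp: independent_sets_def insert_ident)
  have disj: "independent_sets E (A - {v}) \<inter> insert v ` ?N = {}"
    by (auto simp: independent_sets_def)
  have prod: "(\<Prod>i\<in>insert v S. x i) = x v * (\<Prod>i\<in>S. x i)" if "S \<in> ?N" for S
    using that assms(1) by (subst prod.insert) (auto simp: independent_sets_def intro: finite_subset)
  show ?thesis
    using assms(1) unfolding indep_poly_def eq
    by (subst sum.union_disjoint[OF _ _ disj])
      (auto simp: finite_independent_sets sum.reindex[OF inj] prod sum_distrib_left)
qed

text \<open>
  An independent set meets the clique \<open>P\<close> in at most one vertex.
\<close>

lemma indep_poly_remove_clique:
  assumes "finite A" "sym E" "P \<subseteq> A"
    and "\<And>p q. p \<in> P \<Longrightarrow> q \<in> P \<Longrightarrow> p \<noteq> q \<Longrightarrow> (p, q) \<in> E"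
  shows "indep_poly E A x = indep_poly E (A - P) x +
    (\<Sum>p\<in>P. x p * indep_poly E (A - insert p (E `` {p})) x)"
  using finite_subset[OF assms(3,1)] assms
proof (induction P arbitrary: A rule: finite_induct)
  case (insert p P)
  have "A - {p} - insert q (E `` {q}) = A - insert q (E `` {q})" if "q \<in> P" for q
    using insert.hyps insert.prems(4)[of q p] that by auto
  then have rest: "(\<Sum>q\<in>P. x q * indep_poly E (A - {p} - insert q (E `` {q})) x) =
      (\<Sum>q\<in>P. x q * indep_poly E (A - insert q (E `` {q})) x)"
    by simp
  have diff: "A - {p} - P = A - insert p P" by blast
  have "indep_poly E (A - {p}) x = indep_poly E (A - insert p P) x +
      (\<Sum>q\<in>P. x q * indep_poly E (A - insert q (E `` {q})) x)"
    using insert.IH[of "A - {p}"] insert.hyps insert.prems unfolding rest diff by auto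
  then show ?case
    using insert.hyps insert.prems by (simp add: indep_poly_remove[of A E p])
qed simp

text \<open>
  In the expansion of \<open>indep_poly_remove_clique\<close> none of the remaining polynomials involves a coordinate of \<open>P\<close>, so the
  polynomial is affine in these coordinates jointly.
\<close>

lemma indep_poly_scale_clique:
  assumes "finite A" "sym E" "P \<subseteq> A"
    and P: "\<And>p q. p \<in> P \<Longrightarrow> q \<in> P \<Longrightarrow> p \<noteq> q \<Longrightarrow> (p, q) \<in> E"
    and y: "\<And>i. i \<in> P \<Longrightarrow> y i = c * x i" "\<And>i. i \<in> A - P \<Longrightarrow> y i = x i"
  shows "indep_poly E A y = (1 - c) * indep_poly E (A - P) x + c * indep_poly E A x"
proof -
  have "indep_poly E (A - P) y = indep_poly E (A - P) x"
    using y by (intro indep_poly_cong) auto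
  moreover have "indep_poly E (A - insert p (E `` {p})) y = indep_poly E (A - insert p (E `` {p})) x"
    if "p \<in> P" for p
    using y P that by (intro indep_poly_cong) auto
  ultimately show ?thesis
    using assms(1-3) P y(1)
    by (simp add: indep_poly_remove_clique[of A E P] algebra_simps sum_distrib_left)
qed

text \<open>
  The factorization behind the whole proof.  Removing \<open>v\<close> adds \<open>y v\<close> times the polynomial of
  \<open>A - P\<close>, and scaling the clique \<open>P\<close> by \<open>1 + y v\<close> subtracts exactly this term again.
\<close>

lemma indep_poly_insert_simplicial:
  assumes "finite A" "sym E" "v \<notin> A" and nb: "E `` {v} \<inter> A = P"
    and P: "\<And>p q. p \<in> P \<Longrightarrow> q \<in> P \<Longrightarrow> p \<noteq> q \<Longrightarrow> (p, q) \<in> E"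
    and y: "\<And>i. i \<in> P \<Longrightarrow> y i = (1 + y v) * x i" "\<And>i. i \<in> A - P \<Longrightarrow> y i = x i"
  shows "indep_poly E (insert v A) y = (1 + y v) * indep_poly E A x"
proof -
  have "insert v A - {v} = A" "insert v A - insert v (E `` {v}) = A - P"
    using assms by auto
  then have "indep_poly E (insert v A) y = indep_poly E A y + y v * indep_poly E (A - P) y"
    using assms(1,2) by (subst indep_poly_remove[where v = v]) auto
  moreover have "indep_poly E (A - P) y = indep_poly E (A - P) x"
    using y by (intro indep_poly_cong) auto
  moreover have "indep_poly E A y = - y v * indep_poly E (A - P) x + (1 + y v) * indep_poly E A x"
    using indep_poly_scale_clique[of A E P y "1 + y v" x] assms by auto
  ultimately show ?thesis by (simp add: algebra_simps)
qed

lemma cliques_complement_induced: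
  assumes "A \<subseteq> pverts H"
  shows "cliques (complement_graph (with_proj H \<restriction> A)) = independent_sets (parcs H) A"
  by (auto simp: cliques_def complement_graph_def independent_sets_def arcs_ends_def arc_to_ends_def
      induce_subgraph_def)

lemma \<delta>_induced:
  assumes "A \<subseteq> pverts H"
  shows "\<delta> (with_proj H \<restriction> A) x = indep_poly (parcs H) A x"
  using assms by (simp add: \<delta>_def indep_poly_def cliques_complement_induced)

lemma \<Delta>_induced:
  assumes "A \<subseteq> pverts H"
  shows "\<Delta> (with_proj H \<restriction> A) x = indep_poly (parcs H) A (\<lambda>i. - x i)"
  using assms by (simp add: \<Delta>_def indep_poly_def cliques_complement_induced prod.distrib prod_uminus)

lemma induced_induced: "B \<subseteq> A \<Longrightarrow> (G \<restriction> A) \<restriction> B = G \<restriction> B"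
  by (auto simp: induce_subgraph_def)

lemma induced_pverts:
  assumes "pair_wf_digraph H"
  shows "with_proj H \<restriction> pverts H = with_proj H"
proof -
  interpret pair_wf_digraph H by fact
  show ?thesis
    using in_arcsD1 in_arcsD2 by (auto simp: induce_subgraph_def with_proj_def)
qed

text \<open>
  The factor \<open>s\<close> is \<open>-1\<close> for \<open>\<Delta>\<close> and \<open>1\<close> for \<open>\<delta>\<close>.
\<close>

lemma indep_poly_measurable [measurable]:
  assumes "finite W" "A \<subseteq> W"
  shows "(\<lambda>x. indep_poly E A (\<lambda>i. s * x i)) \<in> borel_measurable (lebesgue_on_vectors W)"
proof -
  have "(\<lambda>x. s * x i) \<in> borel_measurable (lebesgue_on_vectors W)"
    if "S \<in> independent_sets E A" "i \<in> S" for S i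
    using that assms(2) by (intro borel_measurable_times measurable_const measurable_component_singleton)
      (auto simp: independent_sets_def)
  then show ?thesis
    unfolding indep_poly_def by (intro borel_measurable_sum borel_measurable_prod)
qed

section \<open>Moral DAGs and their ancestral sets\<close>

locale moral_orientation =
  fixes D :: "'v pair_pre_digraph"
  assumes moral: "moral_dag D"
begin

abbreviation V :: "'v set" where "V \<equiv> pverts D"
abbreviation pa :: "'v \<Rightarrow> 'v set" where "pa \<equiv> parents D"
abbreviation E :: "'v rel" where "E \<equiv> parcs (mk_symmetric (with_proj D))"

sublocale pair_digraph D
  using moral by (simp add: moral_dag_def)

lemma E_eq: "E = parcs D \<union> (parcs D)\<inverse>"
  by (auto simp: parcs_mk_symmetric)

lemma sym_E: "sym E"
  by (auto simp: E_eq sym_def)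

lemma acyclic_arcs: "acyclic (parcs D)"
  using moral by (simp add: moral_dag_def)

lemma wf_arcs: "wf (parcs D)"
  using acyclic_arcs by (intro finite_acyclic_wf) simp_all

lemma obtain_sink:
  assumes "W \<noteq> {}"
  obtains v where "v \<in> W" "\<And>j. (v, j) \<in> parcs D \<Longrightarrow> j \<notin> W"
proof -
  have "wf ((parcs D)\<inverse>)"
    using acyclic_arcs by (intro finite_acyclic_wf_converse) simp_all
  moreover obtain w where "w \<in> W" using assms by blast
  ultimately obtain v where "v \<in> W" "\<And>j. (j, v) \<in> (parcs D)\<inverse> \<Longrightarrow> j \<notin> W"
    by (rule wfE_min) blast
  then show ?thesis using that by simp
qed

lemma parents_clique: "j \<in> pa i \<Longrightarrow> k \<in> pa i \<Longrightarrow> j \<noteq> k \<Longrightarrow> (j, k) \<in> E"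
  using moral by (auto simp: E_eq moral_dag_def)

lemma parents_subset: "pa i \<subseteq> V"
  using in_arcsD1 by (auto simp: parents_def)

definition ancestral :: "'v set \<Rightarrow> bool" where
  "ancestral W \<longleftrightarrow> W \<subseteq> V \<and> (\<forall>i\<in>W. pa i \<subseteq> W)"

lemma finite_ancestral: "ancestral W \<Longrightarrow> finite W"
  unfolding ancestral_def by (blast intro: finite_subset finite_verts)

lemma ancestral_V: "ancestral V"
  using parents_subset by (auto simp: ancestral_def)

lemma not_own_parent: "v \<notin> pa v"
  using acyclic_arcs by (auto simp: parents_def acyclic_def)

text \<open>
  Induction by removing a sink from a parent-closed set.  Within the remaining set the
  neighbours of the sink in the skeleton are its parents.
\<close>

lemma ancestral_induct [consumes 1, case_names empty insert]:
  assumes "ancestral W" and "Q {}"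
    and step: "\<And>v W. \<lbrakk>ancestral W; ancestral (insert v W); v \<in> V; v \<notin> W; pa v \<subseteq> W;
      E `` {v} \<inter> W = pa v; Q W\<rbrakk> \<Longrightarrow> Q (insert v W)"
  shows "Q W"
  using finite_ancestral[OF assms(1)] assms(1)
proof (induction W rule: finite_psubset_induct)
  case (psubset W)
  show ?case
  proof (cases "W = {}")
    case False
    then obtain v where v: "v \<in> W" "\<And>j. (v, j) \<in> parcs D \<Longrightarrow> j \<notin> W"
      by (rule obtain_sink) blast
    have anc: "ancestral (W - {v})"
      using psubset.prems v by (fastforce simp: ancestral_def parents_def)
    have "pa v \<subseteq> W - {v}" "v \<in> V"
      using psubset.prems v not_own_parent by (auto simp: ancestral_def)
    moreover have "E `` {v} \<inter> (W - {v}) = pa v"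
      using calculation v by (auto simp: E_eq parents_def)
    moreover have "Q (W - {v})"
      using psubset.IH[of "W - {v}"] anc v(1) by blast
    ultimately have "Q (insert v (W - {v}))"
      using step[of "W - {v}" v] anc psubset.prems v(1) by (simp add: insert_absorb)
    then show ?thesis using v(1) by (simp add: insert_absorb)
  qed (use assms in simp)
qed

end

section \<open>Removing a sink\<close>

context moral_orientation begin

abbreviation G :: "('v, 'v \<times> 'v) pre_digraph" where
  "G \<equiv> with_proj (mk_symmetric (with_proj D))"

lemma \<Delta>_G: "A \<subseteq> V \<Longrightarrow> \<Delta> (G \<restriction> A) x = indep_poly E A (\<lambda>i. - x i)"
  by (rule \<Delta>_induced) (simp add: mk_symmetric_def)

lemma \<delta>_G: "A \<subseteq> V \<Longrightarrow> \<delta> (G \<restriction> A) x = indep_poly E A x"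
  by (rule \<delta>_induced) (simp add: mk_symmetric_def)

lemma M_dom_G:
  assumes "W \<subseteq> V"
  shows "M_dom (G \<restriction> W) = {x \<in> pos_orthant W. \<forall>A\<subseteq>W. indep_poly E A (\<lambda>i. - x i) > 0}"
proof -
  have "\<Delta> ((G \<restriction> W) \<restriction> A) x = indep_poly E A (\<lambda>i. - x i)" if "A \<subseteq> W" for A x
    using that assms by (simp add: induced_induced \<Delta>_G)
  then show ?thesis by (auto simp: M_dom_def)
qed

lemma pos_orthant_measurable [measurable]:
  "finite W \<Longrightarrow> pos_orthant W \<in> sets (lebesgue_on_vectors W)"
  unfolding pos_orthant_def by (rule sets_PiM_I_finite) auto

lemma pos_orthant_update:
  assumes "v \<notin> W" "P \<subseteq> W" "c > 0" "x \<in> space (lebesgue_on_vectors W)"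
  shows "(scale_on W P c x)(v := u) \<in> pos_orthant (insert v W) \<longleftrightarrow> u > 0 \<and> x \<in> pos_orthant W"
  using assms
  by (auto simp: pos_orthant_def scale_on_def space_PiM PiE_iff extensional_def zero_less_mult_iff
      split: if_splits)

lemma M_dom_measurable:
  assumes "W \<subseteq> V"
  shows "M_dom (G \<restriction> W) \<in> sets (lebesgue_on_vectors W)"
proof -
  have fin: "finite W" using assms finite_verts by (auto intro: finite_subset)
  have "M_dom (G \<restriction> W) = pos_orthant W \<inter>
      {x \<in> space (lebesgue_on_vectors W). \<forall>A\<in>Pow W. indep_poly E A (\<lambda>i. - 1 * x i) > 0}"
    by (auto simp: M_dom_G[OF assms] pos_orthant_def space_PiM)
  also have "\<dots> \<in> sets (lebesgue_on_vectors W)"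
  proof (intro sets.Int pos_orthant_measurable fin sets.sets_Collect_finite_All)
    fix A assume "A \<in> Pow W"
    then have "(\<lambda>x. indep_poly E A (\<lambda>i. - 1 * x i)) \<in> borel_measurable (lebesgue_on_vectors W)"
      by (intro indep_poly_measurable fin) auto
    then show "{x \<in> space (lebesgue_on_vectors W). indep_poly E A (\<lambda>i. - 1 * x i) > 0} \<in> sets (lebesgue_on_vectors W)"
      by measurable
  qed (use fin in auto)
  finally show ?thesis .
qed

lemma dirichlet_kernel_measurable:
  assumes "W \<subseteq> V"
  shows "dirichlet_kernel (G \<restriction> W) \<alpha> \<beta> \<in> borel_measurable (lebesgue_on_vectors W)"
proof -
  have fin: "finite W" using assms finite_verts by (auto intro: finite_subset)
  have [measurable]: "(\<lambda>x. \<Delta> (G \<restriction> W) x) \<in> borel_measurable (lebesgue_on_vectors W)"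
    using indep_poly_measurable[OF fin order_refl, of E "-1"] assms by (simp add: \<Delta>_G)
  show ?thesis unfolding dirichlet_kernel_def by simp
qed

lemma inv_dirichlet_kernel_measurable:
  assumes "W \<subseteq> V"
  shows "inv_dirichlet_kernel (G \<restriction> W) \<alpha> \<beta> \<in> borel_measurable (lebesgue_on_vectors W)"
proof -
  have fin: "finite W" using assms finite_verts by (auto intro: finite_subset)
  have [measurable]: "(\<lambda>x. \<delta> (G \<restriction> W) x) \<in> borel_measurable (lebesgue_on_vectors W)"
    using indep_poly_measurable[OF fin order_refl, of E "1"] assms by (simp add: \<delta>_G)
  show ?thesis unfolding inv_dirichlet_kernel_def by simp
qed

end

text \<open>
  The Jacobian \<open>c ^ card P\<close> cancels the exponents \<open>-1\<close> of the scaled coordinates, which leaves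
  the power \<open>\<Sum>i\<in>P. \<alpha> i\<close> of \<open>c\<close>.
\<close>

lemma prod_powr_scale_on:
  fixes c :: real
  assumes "finite W" "P \<subseteq> W" "v \<notin> W" "c > 0" "\<And>i. i \<in> W \<Longrightarrow> x i > 0"
  shows "c ^ card P * (\<Prod>i\<in>insert v W. ((scale_on W P c x)(v := u)) i powr (\<alpha> i - 1)) =
    u powr (\<alpha> v - 1) * c powr sum \<alpha> P * (\<Prod>i\<in>W. x i powr (\<alpha> i - 1))"
proof -
  have "(\<Prod>i\<in>insert v W. ((scale_on W P c x)(v := u)) i powr (\<alpha> i - 1)) =
      u powr (\<alpha> v - 1) * (\<Prod>i\<in>W. scale_on W P c x i powr (\<alpha> i - 1))"
    using assms by (simp, intro disjI2 prod.cong) auto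
  also have "(\<Prod>i\<in>W. scale_on W P c x i powr (\<alpha> i - 1)) =
      (\<Prod>i\<in>W. (if i \<in> P then c powr (\<alpha> i - 1) else 1) * x i powr (\<alpha> i - 1))"
    using assms by (intro prod.cong) (auto simp: scale_on_def powr_mult)
  also have "\<dots> = (\<Prod>i\<in>P. c powr (\<alpha> i - 1)) * (\<Prod>i\<in>W. x i powr (\<alpha> i - 1))"
    using assms by (simp add: prod.distrib prod.If_cases Int_absorb1)
  finally have "c ^ card P * (\<Prod>i\<in>insert v W. ((scale_on W P c x)(v := u)) i powr (\<alpha> i - 1)) =
      u powr (\<alpha> v - 1) * (\<Prod>i\<in>P. c * c powr (\<alpha> i - 1)) * (\<Prod>i\<in>W. x i powr (\<alpha> i - 1))"
    by (simp add: prod.distrib mult_ac)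
  also have "(\<Prod>i\<in>P. c * c powr (\<alpha> i - 1)) = c powr sum \<alpha> P"
    using assms finite_subset[OF assms(2,1)] by (simp add: powr_mult_base powr_sum)
  finally show ?thesis .
qed

context moral_orientation begin

lemma indep_poly_insert_sink_uminus:
  assumes "ancestral W" "v \<notin> W" "E `` {v} \<inter> W = pa v" "A \<subseteq> W"
  shows "indep_poly E (insert v A) (\<lambda>i. - ((scale_on W (pa v) (1 - u) x)(v := u)) i) =
    (1 - u) * indep_poly E A (\<lambda>i. - x i)"
proof -
  let ?y = "\<lambda>i. - ((scale_on W (pa v) (1 - u) x)(v := u)) i"
  have "indep_poly E (insert v A) ?y = (1 + ?y v) * indep_poly E A (\<lambda>i. - x i)"
  proof (rule indep_poly_insert_simplicial[where P = "pa v \<inter> A"])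
    show "finite A" using assms finite_ancestral by (blast intro: finite_subset)
  qed (use assms sym_E parents_clique in \<open>auto simp: scale_on_def\<close>)
  then show ?thesis by simp
qed

lemma indep_poly_insert_sink:
  assumes "ancestral W" "v \<notin> W" "E `` {v} \<inter> W = pa v"
  shows "indep_poly E (insert v W) ((scale_on W (pa v) (1 + t) y)(v := t)) =
    (1 + t) * indep_poly E W y"
proof -
  let ?y = "(scale_on W (pa v) (1 + t) y)(v := t)"
  have "indep_poly E (insert v W) ?y = (1 + ?y v) * indep_poly E W y"
  proof (rule indep_poly_insert_simplicial[where P = "pa v"])
    show "finite W" using assms finite_ancestral by blast
  qed (use assms sym_E parents_clique in \<open>auto simp: scale_on_def\<close>)
  then show ?thesis by simp
qed

lemma indep_poly_singleton: "indep_poly E {v} x = 1 + x v"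
  using indep_poly_remove[of "{v}" E v x] sym_E by simp

text \<open>
  For \<open>A\<close> containing \<open>v\<close>, the value of \<open>\<Delta>\<^sub>A\<close> at the new point is \<open>1 - u\<close> times its value for \<open>A\<close> without
  \<open>v\<close> at the old point, so that positivity can be read in both directions.  For the other \<open>A\<close> the value
  at the new point is a convex combination of the values for \<open>A - pa v\<close> and \<open>A\<close> at the old point,
  with weights \<open>u\<close> and \<open>1 - u\<close>.
\<close>

lemma M_dom_insert_sink:
  assumes W: "ancestral W" "ancestral (insert v W)" "v \<notin> W" "pa v \<subseteq> W" "E `` {v} \<inter> W = pa v"
    and u: "0 < u" "u < 1" and x: "x \<in> space (lebesgue_on_vectors W)"
  shows "(scale_on W (pa v) (1 - u) x)(v := u) \<in> M_dom (G \<restriction> insert v W) \<longleftrightarrow> x \<in> M_dom (G \<restriction> W)"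
    (is "?y \<in> _ \<longleftrightarrow> _")
proof -
  have sub: "W \<subseteq> V" "insert v W \<subseteq> V" using W by (auto simp: ancestral_def)
  have pos: "?y \<in> pos_orthant (insert v W) \<longleftrightarrow> x \<in> pos_orthant W"
    using pos_orthant_update[of v W "pa v" "1 - u" x u] assms by simp
  have with_v: "indep_poly E (insert v A) (\<lambda>i. - ?y i) = (1 - u) * indep_poly E A (\<lambda>i. - x i)"
    if "A \<subseteq> W" for A
    using indep_poly_insert_sink_uminus[OF W(1,3,5) that] .
  have without_v: "indep_poly E A (\<lambda>i. - ?y i) =
      u * indep_poly E (A - pa v) (\<lambda>i. - x i) + (1 - u) * indep_poly E A (\<lambda>i. - x i)"
    if "A \<subseteq> W" for A
  proof -
    have "indep_poly E A (\<lambda>i. - ?y i) = (1 - (1 - u)) * indep_poly E (A - pa v \<inter> A) (\<lambda>i. - x i) +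
        (1 - u) * indep_poly E A (\<lambda>i. - x i)"
    proof (rule indep_poly_scale_clique)
      show "finite A" using that W(1) finite_ancestral by (blast intro: finite_subset)
    qed (use that W(3) sym_E parents_clique in \<open>auto simp: scale_on_def\<close>)
    moreover have "A - pa v \<inter> A = A - pa v" by blast
    ultimately show ?thesis by simp
  qed
  show ?thesis
  proof
    assume y: "?y \<in> M_dom (G \<restriction> insert v W)"
    have "indep_poly E A (\<lambda>i. - x i) > 0" if "A \<subseteq> W" for A
    proof -
      have "0 < indep_poly E (insert v A) (\<lambda>i. - ?y i)"
        using y that unfolding M_dom_G[OF sub(2)] by blast
      then show ?thesis using with_v[OF that] u by (simp add: zero_less_mult_iff)
    qed
    then show "x \<in> M_dom (G \<restriction> W)"
      using y pos unfolding M_dom_G[OF sub(1)] M_dom_G[OF sub(2)] by simp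
  next
    assume x: "x \<in> M_dom (G \<restriction> W)"
    then have x_pos: "indep_poly E A (\<lambda>i. - x i) > 0" if "A \<subseteq> W" for A
      using that by (simp add: M_dom_G sub)
    have "indep_poly E A (\<lambda>i. - ?y i) > 0" if "A \<subseteq> insert v W" for A
    proof (cases "v \<in> A")
      case True
      have "A - {v} \<subseteq> W" using that by blast
      then show ?thesis
        using with_v[of "A - {v}"] x_pos[of "A - {v}"] u True by (simp add: insert_absorb)
    next
      case False
      then have "A \<subseteq> W" using that by blast
      moreover from this have "A - pa v \<subseteq> W" by blast
      ultimately show ?thesis
        using without_v[of A] x_pos[of A] x_pos[of "A - pa v"] u by (simp add: add_pos_pos)
    qed
    then show "?y \<in> M_dom (G \<restriction> insert v W)"
      using x pos unfolding M_dom_G[OF sub(1)] M_dom_G[OF sub(2)] by simp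
  qed
qed

text \<open>
  The subgraph induced by \<open>{v}\<close> contributes the condition \<open>1 - x v > 0\<close>.
\<close>

lemma M_dom_coordinate_range:
  assumes "W \<subseteq> V" "v \<in> W" "x \<in> M_dom (G \<restriction> W)"
  shows "0 < x v" "x v < 1"
proof -
  have "indep_poly E {v} (\<lambda>i. - x i) > 0" and "x \<in> pos_orthant W"
    using assms by (auto simp: M_dom_G)
  then show "0 < x v" "x v < 1"
    using assms(2) by (auto simp: indep_poly_singleton pos_orthant_def)
qed

section \<open>The two Dirichlet integrals\<close>

text \<open>
  Removing the sink \<open>v\<close> leaves \<open>\<beta>\<close> and the other \<open>\<alpha> i\<close> unchanged, and splits off a Beta integral whose
  second parameter is \<open>\<beta>\<close> from the power of \<open>\<Delta>\<close> plus \<open>sum \<alpha> (pa v)\<close> from the scaled coordinates.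
\<close>

lemma nn_integral_dirichlet:
  assumes "ancestral W" and \<alpha>: "\<And>i. i \<in> V \<Longrightarrow> \<alpha> i > 0" and \<beta>: "\<beta> > 0"
  shows "(\<integral>\<^sup>+x. ennreal (dirichlet_kernel (G \<restriction> W) \<alpha> \<beta> x) * indicator (M_dom (G \<restriction> W)) x
      \<partial>lebesgue_on_vectors W) = ennreal (\<Prod>i\<in>W. Beta (\<alpha> i) (sum \<alpha> (pa i) + \<beta>))"
  using assms(1)
proof (induction rule: ancestral_induct)
  case empty
  interpret product_sigma_finite "\<lambda>_::'v. lborel :: real measure" ..
  have "(\<lambda>_. undefined) \<in> M_dom (G \<restriction> {})" by (simp add: M_dom_G pos_orthant_def)
  then show ?case by (simp add: nn_integral_empty dirichlet_kernel_def \<Delta>_G)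
next
  case (insert v W)
  have sub: "W \<subseteq> V" "insert v W \<subseteq> V" and fin: "finite W"
    using insert.hyps finite_ancestral by (auto simp: ancestral_def)
  have sum_pa: "sum \<alpha> (pa v) \<ge> 0"
    using \<alpha> parents_subset by (intro sum_nonneg) (auto intro: less_imp_le)
  have B_pos: "Beta (\<alpha> v) (sum \<alpha> (pa v) + \<beta>) \<ge> 0"
    using \<alpha> insert.hyps by (intro less_imp_le[OF Beta_real_pos[OF _ add_nonneg_pos[OF sum_pa \<beta>]]]) simp
  note [measurable] = dirichlet_kernel_measurable[OF sub(1)] dirichlet_kernel_measurable[OF sub(2)]
    M_dom_measurable[OF sub(1)] M_dom_measurable[OF sub(2)]
  have "(\<integral>\<^sup>+x. ennreal (dirichlet_kernel (G \<restriction> insert v W) \<alpha> \<beta> x) * indicator (M_dom (G \<restriction> insert v W)) x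
      \<partial>lebesgue_on_vectors (insert v W)) =
    (\<integral>\<^sup>+u. ennreal (u powr (\<alpha> v - 1) * (1 - u) powr ((sum \<alpha> (pa v) + \<beta>) - 1)) * indicator {0<..<1} u \<partial>lborel) *
    (\<integral>\<^sup>+x. ennreal (dirichlet_kernel (G \<restriction> W) \<alpha> \<beta> x) * indicator (M_dom (G \<restriction> W)) x \<partial>lebesgue_on_vectors W)"
  proof (rule nn_integral_split_coordinate[where U = "{0<..<1}" and c = "\<lambda>u. 1 - u" and P = "pa v"])
    fix u :: real and x assume u: "u \<in> {0<..<1}" and x: "x \<in> space (lebesgue_on_vectors W)"
    let ?y = "(scale_on W (pa v) (1 - u) x)(v := u)"
    have dom: "?y \<in> M_dom (G \<restriction> insert v W) \<longleftrightarrow> x \<in> M_dom (G \<restriction> W)"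
      using M_dom_insert_sink[of W v u x] insert.hyps u x by simp
    have "(1 - u) ^ card (pa v) * dirichlet_kernel (G \<restriction> insert v W) \<alpha> \<beta> ?y =
      (u powr (\<alpha> v - 1) * (1 - u) powr ((sum \<alpha> (pa v) + \<beta>) - 1)) * dirichlet_kernel (G \<restriction> W) \<alpha> \<beta> x"
      if "x \<in> M_dom (G \<restriction> W)"
    proof -
      have "indep_poly E W (\<lambda>i. - x i) > 0" and xpos: "\<And>i. i \<in> W \<Longrightarrow> x i > 0"
        using that by (auto simp: M_dom_G sub pos_orthant_def)
      then have "indep_poly E (insert v W) (\<lambda>i. - ?y i) powr (\<beta> - 1) =
          (1 - u) powr (\<beta> - 1) * indep_poly E W (\<lambda>i. - x i) powr (\<beta> - 1)"
        using indep_poly_insert_sink_uminus[of W v W u x] insert.hyps u by (simp add: powr_mult)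
      moreover have "(1 - u) powr ((sum \<alpha> (pa v) + \<beta>) - 1) =
          (1 - u) powr (\<beta> - 1) * (1 - u) powr sum \<alpha> (pa v)"
        by (simp add: powr_add[symmetric] algebra_simps)
      moreover note prod_powr_scale_on[of W "pa v" v "1 - u" x u \<alpha>]
      ultimately show ?thesis
        using fin insert.hyps u xpos
        by (simp add: dirichlet_kernel_def \<Delta>_G sub del: prod.insert)
    qed
    then show "ennreal ((1 - u) ^ card (pa v)) *
        (ennreal (dirichlet_kernel (G \<restriction> insert v W) \<alpha> \<beta> ?y) * indicator (M_dom (G \<restriction> insert v W)) ?y) =
      ennreal (u powr (\<alpha> v - 1) * (1 - u) powr ((sum \<alpha> (pa v) + \<beta>) - 1)) * indicator {0<..<1} u *
        (ennreal (dirichlet_kernel (G \<restriction> W) \<alpha> \<beta> x) * indicator (M_dom (G \<restriction> W)) x)"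
      using u dom by (auto simp: indicator_def ennreal_mult'[symmetric])
  next
    fix u :: real and x assume "u \<notin> {0<..<1}"
    then have "x(v := u) \<notin> M_dom (G \<restriction> insert v W)"
      using M_dom_coordinate_range[OF sub(2), of v "x(v := u)"] by auto
    then show "ennreal (dirichlet_kernel (G \<restriction> insert v W) \<alpha> \<beta> (x(v := u))) *
        indicator (M_dom (G \<restriction> insert v W)) (x(v := u)) = 0"
      by simp
  qed (use insert.hyps fin in auto)
  also have "\<dots> = ennreal (Beta (\<alpha> v) (sum \<alpha> (pa v) + \<beta>)) * ennreal (\<Prod>i\<in>W. Beta (\<alpha> i) (sum \<alpha> (pa i) + \<beta>))"
    unfolding insert.IH using \<alpha> \<beta> insert.hyps sum_pa by (subst nn_integral_Beta) auto
  also have "\<dots> = ennreal (\<Prod>i\<in>insert v W. Beta (\<alpha> i) (sum \<alpha> (pa i) + \<beta>))"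
    using B_pos fin insert.hyps by (simp add: ennreal_mult')
  finally show ?case .
qed

lemma nn_integral_inv_dirichlet:
  assumes "ancestral W" and \<alpha>: "\<And>i. i \<in> V \<Longrightarrow> \<alpha> i > 0"
    and \<beta>: "\<And>i. i \<in> V \<Longrightarrow> \<beta> > sum \<alpha> (closed_parents D i)"
  shows "(\<integral>\<^sup>+y. ennreal (inv_dirichlet_kernel (G \<restriction> W) \<alpha> \<beta> y) * indicator (pos_orthant W) y
      \<partial>lebesgue_on_vectors W) = ennreal (\<Prod>i\<in>W. Beta (\<alpha> i) (\<beta> - sum \<alpha> (closed_parents D i)))"
  using assms(1)
proof (induction rule: ancestral_induct)
  case empty
  interpret product_sigma_finite "\<lambda>_::'v. lborel :: real measure" ..
  have "pos_orthant ({} :: 'v set) = {\<lambda>_. undefined}" by (simp add: pos_orthant_def)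
  then show ?case by (simp add: nn_integral_empty inv_dirichlet_kernel_def \<delta>_G)
next
  case (insert v W)
  have sub: "W \<subseteq> V" "insert v W \<subseteq> V" and fin: "finite W"
    using insert.hyps finite_ancestral by (auto simp: ancestral_def)
  let ?b = "\<beta> - sum \<alpha> (closed_parents D v)"
  have B_pos: "Beta (\<alpha> v) ?b \<ge> 0"
    using \<alpha> \<beta>[of v] insert.hyps by (intro less_imp_le Beta_real_pos) auto
  have b: "\<alpha> v + ?b = \<beta> - sum \<alpha> (pa v)"
    using insert.hyps fin not_own_parent by (simp add: closed_parents_def finite_subset[of "pa v" W])
  note [measurable] = inv_dirichlet_kernel_measurable[OF sub(1)] inv_dirichlet_kernel_measurable[OF sub(2)]
  have [measurable]: "pos_orthant W \<in> sets (lebesgue_on_vectors W)"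
    "pos_orthant (insert v W) \<in> sets (lebesgue_on_vectors (insert v W))"
    using fin by (auto intro: pos_orthant_measurable)
  have "(\<integral>\<^sup>+y. ennreal (inv_dirichlet_kernel (G \<restriction> insert v W) \<alpha> \<beta> y) * indicator (pos_orthant (insert v W)) y
      \<partial>lebesgue_on_vectors (insert v W)) =
    (\<integral>\<^sup>+t. ennreal (t powr (\<alpha> v - 1) * (1 + t) powr (- (\<alpha> v + ?b))) * indicator {0<..} t \<partial>lborel) *
    (\<integral>\<^sup>+y. ennreal (inv_dirichlet_kernel (G \<restriction> W) \<alpha> \<beta> y) * indicator (pos_orthant W) y \<partial>lebesgue_on_vectors W)"
  proof (rule nn_integral_split_coordinate[where U = "{0<..}" and c = "\<lambda>t. 1 + t" and P = "pa v"])
    fix t :: real and y assume t: "t \<in> {0<..}" and y: "y \<in> space (lebesgue_on_vectors W)"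
    let ?z = "(scale_on W (pa v) (1 + t) y)(v := t)"
    have dom: "?z \<in> pos_orthant (insert v W) \<longleftrightarrow> y \<in> pos_orthant W"
      using pos_orthant_update[of v W "pa v" "1 + t" y t] insert.hyps t y by simp
    have "(1 + t) ^ card (pa v) * inv_dirichlet_kernel (G \<restriction> insert v W) \<alpha> \<beta> ?z =
      (t powr (\<alpha> v - 1) * (1 + t) powr (- (\<alpha> v + ?b))) * inv_dirichlet_kernel (G \<restriction> W) \<alpha> \<beta> y"
      if "y \<in> pos_orthant W"
    proof -
      have ypos: "\<And>i. i \<in> W \<Longrightarrow> y i > 0"
        using that by (auto simp: pos_orthant_def)
      then have "indep_poly E W y \<ge> 0"
        unfolding indep_poly_def
        by (intro sum_nonneg prod_nonneg) (auto simp: independent_sets_def intro: less_imp_le)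
      then have "indep_poly E (insert v W) ?z powr (- \<beta>) =
          (1 + t) powr (- \<beta>) * indep_poly E W y powr (- \<beta>)"
        using indep_poly_insert_sink[of W v t y] insert.hyps t by (simp add: powr_mult)
      moreover have "(1 + t) powr (- (\<alpha> v + ?b)) = (1 + t) powr (- \<beta>) * (1 + t) powr sum \<alpha> (pa v)"
        unfolding b by (simp add: powr_add[symmetric])
      moreover note prod_powr_scale_on[of W "pa v" v "1 + t" y t \<alpha>]
      ultimately show ?thesis
        using fin insert.hyps t ypos
        by (simp add: inv_dirichlet_kernel_def \<delta>_G sub del: prod.insert)
    qed
    then show "ennreal ((1 + t) ^ card (pa v)) *
        (ennreal (inv_dirichlet_kernel (G \<restriction> insert v W) \<alpha> \<beta> ?z) * indicator (pos_orthant (insert v W)) ?z) =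
      ennreal (t powr (\<alpha> v - 1) * (1 + t) powr (- (\<alpha> v + ?b))) * indicator {0<..} t *
        (ennreal (inv_dirichlet_kernel (G \<restriction> W) \<alpha> \<beta> y) * indicator (pos_orthant W) y)"
      using t dom by (auto simp: indicator_def ennreal_mult'[symmetric])
  next
    fix t :: real and y assume "t \<notin> {0<..}"
    then show "ennreal (inv_dirichlet_kernel (G \<restriction> insert v W) \<alpha> \<beta> (y(v := t))) *
        indicator (pos_orthant (insert v W)) (y(v := t)) = 0"
      by (auto simp: pos_orthant_def indicator_def PiE_iff)
  qed (use insert.hyps fin in auto)
  also have "\<dots> = ennreal (Beta (\<alpha> v) ?b) * ennreal (\<Prod>i\<in>W. Beta (\<alpha> i) (\<beta> - sum \<alpha> (closed_parents D i)))"
    unfolding insert.IH using \<alpha> \<beta>[of v] insert.hyps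
    by (subst nn_integral_Beta_prime) auto
  also have "\<dots> = ennreal (\<Prod>i\<in>insert v W. Beta (\<alpha> i) (\<beta> - sum \<alpha> (closed_parents D i)))"
    using B_pos fin insert.hyps by (simp add: ennreal_mult')
  finally show ?case .
qed

end

section \<open>Existence of perfect orderings\<close>

lemma max_cliques_clique: "C \<in> max_cliques H \<Longrightarrow> C \<in> cliques H"
  and max_cliques_maximal: "C \<in> max_cliques H \<Longrightarrow> K \<in> cliques H \<Longrightarrow> C \<subseteq> K \<Longrightarrow> K = C"
  and max_cliquesI: "C \<in> cliques H \<Longrightarrow> (\<And>K. K \<in> cliques H \<Longrightarrow> C \<subseteq> K \<Longrightarrow> K = C) \<Longrightarrow> C \<in> max_cliques H"
  by (simp_all add: max_cliques_def)

lemma clique_in_max_clique: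
  assumes "finite (cliques H)" "T \<in> cliques H"
  obtains C where "C \<in> max_cliques H" "T \<subseteq> C"
proof -
  obtain C where "C \<in> cliques H" "T \<subseteq> C" "\<And>C'. C' \<in> cliques H \<Longrightarrow> C \<subseteq> C' \<Longrightarrow> C' = C"
    using finite_has_maximal2[OF assms] by metis
  then show ?thesis by (intro that max_cliquesI) auto
qed

context moral_orientation begin

lemma cliques_G_induced:
  "W \<subseteq> V \<Longrightarrow> cliques (G \<restriction> W) = {C. C \<subseteq> W \<and> (\<forall>u\<in>C. \<forall>v\<in>C. u \<noteq> v \<longrightarrow> (u, v) \<in> E)}"
  by (auto simp: cliques_def arcs_ends_def arc_to_ends_def induce_subgraph_def)

text \<open>
  A clique that contains \<open>v\<close> lies in \<open>insert v (pa v)\<close>, which is itself a clique.  Hence this is the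
  only new maximal clique, and the only old one that can be lost is \<open>pa v\<close>.
\<close>

lemma max_cliques_insert_sink:
  assumes W: "ancestral (insert v W)" "v \<notin> W" "pa v \<subseteq> W" "E `` {v} \<inter> W = pa v"
  shows "max_cliques (G \<restriction> insert v W) = insert (insert v (pa v)) (max_cliques (G \<restriction> W) - {pa v})"
proof -
  have sub: "W \<subseteq> V" "insert v W \<subseteq> V" using W(1) by (auto simp: ancestral_def)
  let ?P = "pa v" and ?K = "cliques (G \<restriction> W)" and ?K' = "cliques (G \<restriction> insert v W)"
  have P: "?P \<in> ?K" "insert v ?P \<in> ?K'"
    using W parents_clique sym_E by (auto simp: cliques_G_induced[OF sub(1)] cliques_G_induced[OF sub(2)] dest: symD)
  have mono: "C \<in> ?K' \<longleftrightarrow> C \<in> ?K" if "v \<notin> C" for C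
    using that unfolding cliques_G_induced[OF sub(1)] cliques_G_induced[OF sub(2)] by blast
  have with_v: "C \<subseteq> insert v ?P" if "C \<in> ?K'" "v \<in> C" for C
  proof
    fix u assume "u \<in> C"
    then have "u = v \<or> u \<in> E `` {v} \<inter> W"
      using that by (auto simp: cliques_G_induced[OF sub(2)])
    then show "u \<in> insert v ?P" unfolding W(4) by blast
  qed
  have v_notin: "v \<notin> C" if "C \<in> ?K" for C
    using that W(2) unfolding cliques_G_induced[OF sub(1)] by blast
  show ?thesis
  proof (intro antisym subsetI)
    fix C assume C: "C \<in> max_cliques (G \<restriction> insert v W)"
    note C_clique = max_cliques_clique[OF C]
    show "C \<in> insert (insert v ?P) (max_cliques (G \<restriction> W) - {?P})"
    proof (cases "v \<in> C")
      case True
      have "insert v ?P = C"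
        using max_cliques_maximal[OF C P(2) with_v[OF C_clique True]] .
      then show ?thesis by simp
    next
      case False
      have "C \<noteq> ?P" using max_cliques_maximal[OF C P(2)] False by auto
      moreover have "C \<in> max_cliques (G \<restriction> W)"
        using max_cliques_maximal[OF C] C_clique mono[OF False] mono[OF v_notin]
        by (intro max_cliquesI) auto
      ultimately show ?thesis by simp
    qed
  next
    fix C assume C: "C \<in> insert (insert v ?P) (max_cliques (G \<restriction> W) - {?P})"
    show "C \<in> max_cliques (G \<restriction> insert v W)"
    proof (cases "C = insert v ?P")
      case True
      show ?thesis
        unfolding True
      proof (rule max_cliquesI[OF P(2)])
        fix K assume "K \<in> ?K'" "insert v ?P \<subseteq> K"
        then show "K = insert v ?P" using with_v[of K] by blast
      qed
    next
      case False
      then have C': "C \<in> max_cliques (G \<restriction> W)" "C \<noteq> ?P" using C by auto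
      note C_clique = max_cliques_clique[OF C'(1)]
      show ?thesis
      proof (rule max_cliquesI)
        show "C \<in> ?K'" using C_clique mono[OF v_notin[OF C_clique]] by simp
        fix K assume K: "K \<in> ?K'" "C \<subseteq> K"
        show "K = C"
        proof (cases "v \<in> K")
          case True
          then have "C \<subseteq> ?P" using with_v[OF K(1)] K(2) v_notin[OF C_clique] by blast
          then show ?thesis using max_cliques_maximal[OF C'(1) P(1)] C'(2) by simp
        next
          case False
          then show ?thesis using max_cliques_maximal[OF C'(1)] mono[OF False] K by simp
        qed
      qed
    qed
  qed
qed

text \<open>
  When the sink \<open>v\<close> is added, its closed parent set takes the position of \<open>pa v\<close> if this was a
  maximal clique; the separators do not change because \<open>v\<close> lies in a single member.  Otherwise
  the closed parent set is appended; its separator lies in \<open>pa v\<close>, which is contained in some earlier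
  maximal clique.  The empty graph has the maximal clique \<open>{}\<close>, which the first vertex replaces.
\<close>

lemma ex_perfect_ordering:
  assumes "ancestral W"
  shows "\<exists>Cs. perfect_ordering (G \<restriction> W) Cs"
  using assms
proof (induction rule: ancestral_induct)
  case empty
  have "perfect_ordering (G \<restriction> {}) [{}]"
    by (auto simp: perfect_ordering_def max_cliques_def cliques_G_induced)
  then show ?case by blast
next
  case (insert v W)
  have sub: "W \<subseteq> V" using insert.hyps by (auto simp: ancestral_def)
  obtain Cs where Cs: "distinct Cs" "set Cs = max_cliques (G \<restriction> W)"
    and po: "\<And>k. k \<in> {1..<length Cs} \<Longrightarrow> \<exists>l<k. sep Cs k \<subseteq> Cs ! l"
    using insert.IH unfolding perfect_ordering_def by blast
  note max_eq = max_cliques_insert_sink[OF insert.hyps(2,4-6)]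
  have P: "pa v \<in> cliques (G \<restriction> W)"
    using insert.hyps parents_clique by (auto simp: cliques_G_induced sub)
  have Cs_W: "Cs ! k \<subseteq> W" if "k < length Cs" for k
  proof -
    have "Cs ! k \<in> max_cliques (G \<restriction> W)" using nth_mem[OF that] Cs(2) by simp
    then show ?thesis by (simp add: max_cliques_def cliques_G_induced[OF sub])
  qed
  then have v_Cs: "v \<notin> Cs ! k" if "k < length Cs" for k
    using that insert.hyps by blast
  show ?case
  proof (cases "pa v \<in> max_cliques (G \<restriction> W)")
    case True
    then obtain n where n: "n < length Cs" "Cs ! n = pa v"
      using Cs(2) by (metis in_set_conv_nth)
    let ?Cs = "Cs[n := insert v (pa v)]"
    have nth: "?Cs ! k = (if k = n then insert v (Cs ! k) else Cs ! k)" if "k < length Cs" for k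
      using that n by simp
    have new: "insert v (pa v) \<notin> set Cs"
      using v_Cs by (auto simp: in_set_conv_nth)
    have "\<exists>l<k. sep ?Cs k \<subseteq> ?Cs ! l" if k: "k \<in> {1..<length ?Cs}" for k
    proof -
      obtain l where l: "l < k" "sep Cs k \<subseteq> Cs ! l" using po k by auto
      have "sep ?Cs k \<subseteq> sep Cs k"
        using k v_Cs by (auto simp: sep_def nth split: if_splits)
      also have "\<dots> \<subseteq> ?Cs ! l" using l k nth[of l] by auto
      finally show ?thesis using l by blast
    qed
    moreover have "distinct ?Cs" using Cs(1) new by (intro distinct_list_update) auto
    moreover have "set ?Cs = max_cliques (G \<restriction> insert v W)"
      using Cs n by (simp add: max_eq set_update_distinct)
    ultimately have "perfect_ordering (G \<restriction> insert v W) ?Cs"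
      by (simp add: perfect_ordering_def)
    then show ?thesis by blast
  next
    case False
    let ?Cs = "Cs @ [insert v (pa v)]"
    have new: "insert v (pa v) \<notin> set Cs"
      using v_Cs by (auto simp: in_set_conv_nth)
    have "finite (cliques (G \<restriction> W))"
      using finite_ancestral[OF insert.hyps(1)] by (auto simp: cliques_G_induced[OF sub])
    then obtain C where "C \<in> max_cliques (G \<restriction> W)" "pa v \<subseteq> C"
      using P by (rule clique_in_max_clique)
    then obtain n where n: "n < length Cs" "pa v \<subseteq> Cs ! n"
      using Cs(2) by (metis in_set_conv_nth)
    have "\<exists>l<k. sep ?Cs k \<subseteq> ?Cs ! l" if k: "k \<in> {1..<length ?Cs}" for k
    proof (cases "k = length Cs")
      case True
      have "sep ?Cs k \<subseteq> pa v"
        using v_Cs by (auto simp: sep_def True nth_append)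
      then show ?thesis using n True by (auto simp: nth_append intro!: exI[of _ n])
    next
      case False
      then have "k < length Cs" using k by auto
      then have "sep ?Cs k = sep Cs k" and "\<exists>l<k. sep Cs k \<subseteq> Cs ! l"
        using po[of k] k by (auto simp: sep_def nth_append)
      then show ?thesis using \<open>k < length Cs\<close> by (auto simp: nth_append)
    qed
    moreover have "set ?Cs = max_cliques (G \<restriction> insert v W)"
      using Cs False by (simp add: max_eq)
    ultimately have "perfect_ordering (G \<restriction> insert v W) ?Cs"
      using Cs(1) new by (simp add: perfect_ordering_def)
    then show ?thesis by blast
  qed
qed

end

section \<open>Parent sets versus cliques and separators\<close>

text \<open>
  Moebius inversion on the subset order, in the form of a maximality argument: at a maximal set
  where the multiplicities differ, all strict supersets have equal multiplicities, so that the superset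
  counts differ as well.
\<close>

lemma multiset_eq_if_superset_counts_eq:
  fixes M N :: "'a set multiset"
  assumes counts: "\<And>T. size {#S \<in># M. T \<subseteq> S#} = size {#S \<in># N. T \<subseteq> S#}"
  shows "M = N"
proof (rule ccontr)
  assume "M \<noteq> N"
  define X where "X = {S. count M S \<noteq> count N S}"
  have "X \<subseteq> set_mset (M + N)" by (auto simp: X_def not_in_iff)
  then have "finite X" by (rule finite_subset) simp
  moreover have "X \<noteq> {}" using \<open>M \<noteq> N\<close> by (auto simp: X_def multiset_eq_iff)
  ultimately obtain T where T: "T \<in> X" "\<And>S. S \<in> X \<Longrightarrow> T \<subseteq> S \<Longrightarrow> S = T"
    using finite_has_maximal[of X] by metis
  have split: "{#S \<in># K. T \<subseteq> S#} = {#S \<in># K. T \<subset> S#} + replicate_mset (count K T) T" for K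
    by (rule multiset_eqI) auto
  have "{#S \<in># M. T \<subset> S#} = {#S \<in># N. T \<subset> S#}"
    using T(2) by (intro multiset_eqI) (auto simp: X_def)
  then have "count M T = count N T"
    using counts[of T] by (simp add: split)
  then show False using T(1) by (simp add: X_def)
qed

lemma size_filter_image_mset:
  "finite I \<Longrightarrow> size {#S \<in># image_mset f (mset_set I). Q S#} = card {i \<in> I. Q (f i)}"
  by (simp add: filter_mset_image_mset size_mset_set[symmetric] del: size_mset_set)

lemma card_filter_ex1:
  assumes "\<exists>!i. i \<in> I \<and> Q i"
  shows "card {i \<in> I. Q i} = 1"
proof -
  from assms obtain i where "{i \<in> I. Q i} = {i}" by blast
  then show ?thesis by simp
qed

lemma sep_subset: "sep Cs k \<subseteq> Cs ! k" by (simp add: sep_def)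

text \<open>
  The product runs over all \<open>k\<close> including \<open>0\<close>.  As \<open>sep Cs 0 = {}\<close>, this only adds a factor \<open>g {}\<close>,
  and it brings the exponent of \<open>g {}\<close> from \<open>m - 1\<close> to the number \<open>m\<close> of components.
\<close>

lemma prod_separators:
  fixes g :: "'v set \<Rightarrow> real"
  shows "(\<Prod>k<length Cs. g (sep Cs k)) =
    g {} ^ card {k \<in> {..<length Cs}. sep Cs k = {}} *
    (\<Prod>S\<in>min_separators Cs. g S ^ sep_multiplicity Cs S)"
proof -
  let ?I = "{k \<in> {..<length Cs}. sep Cs k = {}}" and ?J = "{k \<in> {1..<length Cs}. sep Cs k \<noteq> {}}"
  have "sep Cs 0 = {}" by (simp add: sep_def)
  then have "k \<ge> 1" if "sep Cs k \<noteq> {}" for k using that by (cases k) auto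
  then have "{..<length Cs} = ?I \<union> ?J" by auto
  then have "(\<Prod>k<length Cs. g (sep Cs k)) = (\<Prod>k\<in>?I \<union> ?J. g (sep Cs k))"
    by (rule prod.cong) simp
  also have "\<dots> = (\<Prod>k\<in>?I. g (sep Cs k)) * (\<Prod>k\<in>?J. g (sep Cs k))"
    by (rule prod.union_disjoint) auto
  also have "(\<Prod>k\<in>?I. g (sep Cs k)) = g {} ^ card ?I" by simp
  also have "(\<Prod>k\<in>?J. g (sep Cs k)) =
      (\<Prod>S\<in>sep Cs ` ?J. \<Prod>k\<in>{k \<in> ?J. sep Cs k = S}. g (sep Cs k))"
    by (rule prod.image_gen) simp
  also have "sep Cs ` ?J = min_separators Cs" by (auto simp: min_separators_def)
  also have "(\<Prod>S\<in>min_separators Cs. \<Prod>k\<in>{k \<in> ?J. sep Cs k = S}. g (sep Cs k)) =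
      (\<Prod>S\<in>min_separators Cs. g S ^ sep_multiplicity Cs S)"
  proof (rule prod.cong[OF refl])
    fix S assume "S \<in> min_separators Cs"
    then have "{k \<in> ?J. sep Cs k = S} = {k \<in> {1..<length Cs}. sep Cs k = S}"
      by (auto simp: min_separators_def)
    then show "(\<Prod>k\<in>{k \<in> ?J. sep Cs k = S}. g (sep Cs k)) = g S ^ sep_multiplicity Cs S"
      by (simp add: sep_multiplicity_def)
  qed
  finally show ?thesis .
qed

context moral_orientation begin

lemma cliques_G: "cliques G = {C. C \<subseteq> V \<and> (\<forall>u\<in>C. \<forall>v\<in>C. u \<noteq> v \<longrightarrow> (u, v) \<in> E)}"
  by (simp add: cliques_def mk_symmetric_def)

lemma finite_cliques_G: "finite (cliques G)"
  by (rule finite_subset[of _ "Pow V"]) (auto simp: cliques_G)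

lemma closed_parents_clique: "i \<in> V \<Longrightarrow> closed_parents D i \<in> cliques G"
  using parents_clique parents_subset by (auto simp: cliques_G closed_parents_def E_eq parents_def)

text \<open>
  The vertices singled out are those of \<open>T\<close> that have all other vertices of \<open>T\<close> as parents.  A sink
  of \<open>T\<close> is one because \<open>T\<close> is a clique, and two of them would be parents of each other.
\<close>

lemma ex1_last_vertex:
  assumes "T \<in> cliques G" "T \<noteq> {}"
  shows "\<exists>!i. i \<in> V \<and> T \<subseteq> closed_parents D i \<and> \<not> T \<subseteq> pa i"
proof -
  have T: "T \<subseteq> V" "\<And>u v. u \<in> T \<Longrightarrow> v \<in> T \<Longrightarrow> u \<noteq> v \<Longrightarrow> (u, v) \<in> parcs D \<or> (v, u) \<in> parcs D"
    using assms by (auto simp: cliques_G E_eq)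
  have last: "T \<subseteq> closed_parents D i \<and> \<not> T \<subseteq> pa i \<longleftrightarrow> i \<in> T \<and> T \<subseteq> closed_parents D i" for i
    using not_own_parent by (auto simp: closed_parents_def)
  obtain i where i: "i \<in> T" "\<And>j. (i, j) \<in> parcs D \<Longrightarrow> j \<notin> T"
    using assms(2) by (rule obtain_sink) blast
  have i_last: "T \<subseteq> closed_parents D i"
    using i T(2)[OF _ i(1)] by (auto simp: closed_parents_def parents_def)
  have asym: "(j, i) \<notin> parcs D" if "(i, j) \<in> parcs D" for i j
    using acyclic_arcs that by (meson acyclic_def trancl.simps)
  show ?thesis
    unfolding last
  proof (rule ex1I[of _ i])
    fix j assume j: "j \<in> V \<and> j \<in> T \<and> T \<subseteq> closed_parents D j"
    show "j = i"
      using i i_last j asym by (auto simp: closed_parents_def parents_def)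
  qed (use i i_last T in auto)
qed

text \<open>
  The first maximal clique of the ordering that contains \<open>T\<close> qualifies: otherwise \<open>T\<close> would lie in its
  separator, and by perfectness in an earlier member.  For every later member that contains \<open>T\<close>, the set
  \<open>T\<close> lies in the intersection with the first one, hence in the separator.
\<close>

lemma ex1_first_max_clique:
  assumes po: "perfect_ordering G Cs" and "T \<in> cliques G" "T \<noteq> {}"
  shows "\<exists>!k. k \<in> {..<length Cs} \<and> T \<subseteq> Cs ! k \<and> \<not> T \<subseteq> sep Cs k"
proof -
  obtain C where "C \<in> set Cs" "T \<subseteq> C"
    using clique_in_max_clique[OF finite_cliques_G assms(2)] po by (auto simp: perfect_ordering_def)
  then obtain n where "n < length Cs \<and> T \<subseteq> Cs ! n" by (auto simp: in_set_conv_nth)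
  then obtain k where k: "k < length Cs" "T \<subseteq> Cs ! k"
    and least: "\<And>l. l < k \<Longrightarrow> \<not> (l < length Cs \<and> T \<subseteq> Cs ! l)"
    using exists_least_iff[of "\<lambda>n. n < length Cs \<and> T \<subseteq> Cs ! n"] by blast
  have "\<not> T \<subseteq> sep Cs k"
  proof
    assume T: "T \<subseteq> sep Cs k"
    then have "k \<noteq> 0" using assms(3) by (auto simp: sep_def)
    then have "k \<in> {1..<length Cs}" using k(1) by simp
    then obtain l where l: "l < k" "sep Cs k \<subseteq> Cs ! l"
      using po unfolding perfect_ordering_def by blast
    then have "\<not> T \<subseteq> Cs ! l" using least[of l] k(1) by simp
    then show False using T l(2) by blast
  qed
  moreover have "T \<subseteq> sep Cs l" if "k < l" "T \<subseteq> Cs ! l" for l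
    using that k(2) by (auto simp: sep_def)
  ultimately show ?thesis
    using k least by (intro ex1I[of _ k]) (simp, metis lessThan_iff linorder_neqE_nat)
qed

text \<open>
  On each side, compare the members above a set \<open>T\<close>.  The surplus of the closed parent sets over the
  parent sets counts the last vertices of \<open>T\<close>, the surplus of the maximal cliques over the separators
  counts the first maximal cliques of \<open>T\<close>; both are \<open>1\<close> if \<open>T\<close> is a nonempty clique, and \<open>0\<close> otherwise.
\<close>

lemma parents_separators_multiset:
  assumes po: "perfect_ordering G Cs"
  shows "image_mset (closed_parents D) (mset_set V) + image_mset (sep Cs) (mset_set {..<length Cs}) =
    image_mset pa (mset_set V) + image_mset ((!) Cs) (mset_set {..<length Cs})"
proof (rule multiset_eq_if_superset_counts_eq)
  have max: "Cs ! k \<in> cliques G" if "k < length Cs" for k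
    using po nth_mem[OF that] by (auto simp: perfect_ordering_def max_cliques_def)
  show "size {#S \<in># image_mset (closed_parents D) (mset_set V) + image_mset (sep Cs) (mset_set {..<length Cs}). T \<subseteq> S#} =
    size {#S \<in># image_mset pa (mset_set V) + image_mset ((!) Cs) (mset_set {..<length Cs}). T \<subseteq> S#}" for T
  proof -
    have "card {i \<in> V. T \<subseteq> closed_parents D i} =
        card {i \<in> V. T \<subseteq> pa i} + card {i \<in> V. T \<subseteq> closed_parents D i \<and> \<not> T \<subseteq> pa i}"
      by (subst card_Un_disjoint[symmetric]) (auto intro!: arg_cong[where f = card] simp: closed_parents_def)
    moreover have "card {k \<in> {..<length Cs}. T \<subseteq> Cs ! k} =
        card {k \<in> {..<length Cs}. T \<subseteq> sep Cs k} + card {k \<in> {..<length Cs}. T \<subseteq> Cs ! k \<and> \<not> T \<subseteq> sep Cs k}"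
      using order_trans[OF _ sep_subset[of Cs]]
      by (subst card_Un_disjoint[symmetric]) (auto intro!: arg_cong[where f = card])
    moreover have "card {i \<in> V. T \<subseteq> closed_parents D i \<and> \<not> T \<subseteq> pa i} =
        card {k \<in> {..<length Cs}. T \<subseteq> Cs ! k \<and> \<not> T \<subseteq> sep Cs k}"
    proof (cases "T \<in> cliques G \<and> T \<noteq> {}")
      case True
      then show ?thesis
        using card_filter_ex1[OF ex1_last_vertex] card_filter_ex1[OF ex1_first_max_clique[OF po]] by simp
    next
      case False
      have sub_clique: "T \<in> cliques G" if "T \<subseteq> C" "C \<in> cliques G" for C
        using that by (auto simp: cliques_G)
      have "{i \<in> V. T \<subseteq> closed_parents D i \<and> \<not> T \<subseteq> pa i} = {}"
        "{k \<in> {..<length Cs}. T \<subseteq> Cs ! k \<and> \<not> T \<subseteq> sep Cs k} = {}"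
        using False sub_clique closed_parents_clique max by blast+
      then show ?thesis by (simp only: card.empty)
    qed
    ultimately show ?thesis by (simp add: size_filter_image_mset)
  qed
qed

lemma prod_parents_separators_cliques:
  fixes g :: "'v set \<Rightarrow> real"
  assumes po: "perfect_ordering G Cs"
  shows "(\<Prod>i\<in>V. g (closed_parents D i)) * (\<Prod>k<length Cs. g (sep Cs k)) =
    (\<Prod>i\<in>V. g (pa i)) * (\<Prod>C\<in>max_cliques G. g C)"
proof -
  have "(\<Prod>k<length Cs. g (Cs ! k)) = (\<Prod>C\<in>max_cliques G. g C)"
    using po prod.reindex_bij_betw[OF bij_betw_nth[of Cs "{..<length Cs}" "set Cs"], of g]
    by (simp add: perfect_ordering_def)
  then show ?thesis
    using arg_cong[OF parents_separators_multiset[OF po], of "\<lambda>M. prod_mset (image_mset g M)"]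
    by (simp add: image_mset.compositionality o_def prod_unfold_prod_mset[symmetric])
qed

text \<open>
  This is the multiplicity of the empty set in \<open>parents_separators_multiset\<close>.
\<close>

lemma card_empty_separators:
  assumes po: "perfect_ordering G Cs" and "V \<noteq> {}"
  shows "card {k \<in> {..<length Cs}. sep Cs k = {}} = card {i \<in> V. pa i = {}}"
proof -
  have "Cs ! k \<noteq> {}" if "k < length Cs" for k
  proof
    assume empty: "Cs ! k = {}"
    have "Cs ! k \<in> max_cliques G" using po that by (auto simp: perfect_ordering_def)
    moreover obtain i where "i \<in> V" using assms by blast
    ultimately show False using closed_parents_clique[of i] empty
      by (auto simp: max_cliques_def closed_parents_def)
  qed
  then have "{k \<in> {..<length Cs}. Cs ! k = {}} = {}" by blast
  then have "card {k \<in> {..<length Cs}. Cs ! k = {}} = 0" by (simp only: card.empty)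
  moreover have "card {i \<in> V. closed_parents D i = {}} = 0" by (simp add: closed_parents_def)
  moreover have "card {i \<in> V. closed_parents D i = {}} + card {k \<in> {..<length Cs}. sep Cs k = {}} =
      card {i \<in> V. pa i = {}} + card {k \<in> {..<length Cs}. Cs ! k = {}}"
    using arg_cong[OF parents_separators_multiset[OF po], of "\<lambda>M. size {#S \<in># M. S = {}#}"]
    by (simp add: size_filter_image_mset)
  ultimately show ?thesis by linarith
qed

section \<open>Connected components and sources\<close>

inductive source_of :: "'v \<Rightarrow> 'v \<Rightarrow> bool" where
  source: "s \<in> V \<Longrightarrow> pa s = {} \<Longrightarrow> source_of s s"
| descend: "source_of s j \<Longrightarrow> (j, i) \<in> parcs D \<Longrightarrow> source_of s i"

lemma ex_source: "i \<in> V \<Longrightarrow> \<exists>s. source_of s i"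
proof -
  from wf_arcs show "i \<in> V \<Longrightarrow> \<exists>s. source_of s i"
  proof (induction i rule: wf_induct_rule)
    case (less i)
    show ?case
    proof (cases "pa i = {}")
      case False
      then obtain j where "(j, i) \<in> parcs D" by (auto simp: parents_def)
      then show ?thesis using less source_of.descend in_arcsD1 by blast
    qed (use less source_of.source in blast)
  qed
qed

lemma source_of_via_parent:
  assumes "source_of s i" "pa i \<noteq> {}"
  shows "\<exists>j. source_of s j \<and> (j, i) \<in> parcs D"
  using assms(1) by cases (use assms(2) in auto)

lemma source_of_source: "source_of s i \<Longrightarrow> pa i = {} \<Longrightarrow> s = i"
  by (erule source_of.cases) (auto simp: parents_def)

text \<open>
  Two distinct parents of \<open>i\<close> are adjacent by morality, so a source above one of them is also
  above the other, where uniqueness holds by induction.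
\<close>

lemma source_unique: "source_of s i \<Longrightarrow> source_of t i \<Longrightarrow> s = t"
proof -
  from wf_arcs show "source_of s i \<Longrightarrow> source_of t i \<Longrightarrow> s = t"
  proof (induction i arbitrary: s t rule: wf_induct_rule)
    case (less i)
    show ?case
    proof (cases "pa i = {}")
      case True
      then show ?thesis using less.prems source_of_source by blast
    next
      case False
      obtain j k where j: "source_of s j" "(j, i) \<in> parcs D" and k: "source_of t k" "(k, i) \<in> parcs D"
        using source_of_via_parent[OF less.prems(1) False] source_of_via_parent[OF less.prems(2) False]
        by blast
      consider "j = k" | "(j, k) \<in> parcs D" | "(k, j) \<in> parcs D"
        using j(2) k(2) moral by (auto simp: moral_dag_def parents_def)
      then show ?thesis
        using less.IH j k source_of.descend by cases blast+
    qed
  qed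
qed

lemma source_of_adjacent:
  assumes "(i, j) \<in> E" "source_of s i"
  shows "source_of s j"
proof (cases "(i, j) \<in> parcs D")
  case False
  then have ji: "(j, i) \<in> parcs D" using assms(1) by (auto simp: E_eq)
  then obtain t where "source_of t j" using ex_source in_arcsD1 by blast
  then show ?thesis using source_unique source_of.descend[OF _ ji] assms(2) by blast
qed (use assms source_of.descend in blast)

lemma pair_graph_skeleton: "pair_graph (mk_symmetric (with_proj D))"
proof -
  interpret G: pair_digraph "mk_symmetric (with_proj D)"
    by (rule digraph_mk_symmetric)
  show ?thesis
    by unfold_locales (rule symmetric_mk_symmetric)
qed

text \<open>
  Adjacent vertices have the same source, hence so do all vertices of a component, and each vertex is
  connected to its source.
\<close>

lemma num_components_eq_sources: "num_components G = card {i \<in> V. pa i = {}}"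
proof -
  interpret G: pair_graph "mk_symmetric (with_proj D)"
    by (rule pair_graph_skeleton)
  have V_G: "pverts (mk_symmetric (with_proj D)) = V" by simp
  have reach_source: "source_of s j" if "i \<rightarrow>\<^sup>*\<^bsub>G\<^esub> j" "source_of s i" for s i j
    using that by (induction rule: G.reachable_induct) (auto intro: source_of_adjacent)
  have source_reach: "s \<rightarrow>\<^sup>*\<^bsub>G\<^esub> i" if "source_of s i" for s i
    using that
  proof induction
    case (source s)
    then show ?case using V_G by (intro G.reachable_refl) simp
  next
    case (descend s j i)
    then show ?case by (intro G.reachable_adj_trans[of s j i]) (auto simp: E_eq)
  qed
  have "inj_on G.scc_of {i \<in> V. pa i = {}}"
  proof (rule inj_onI)
    fix s t assume s: "s \<in> {i \<in> V. pa i = {}}" and t: "t \<in> {i \<in> V. pa i = {}}"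
      and eq: "G.scc_of s = G.scc_of t"
    have "t \<in> G.scc_of s" unfolding eq using t V_G by (auto simp: G.scc_of_def)
    then have "s \<rightarrow>\<^sup>*\<^bsub>G\<^esub> t" by (simp add: G.scc_of_def)
    then have "source_of s t" using s reach_source source_of.source by blast
    then show "s = t" using t source_unique source_of.source by blast
  qed
  moreover have "G.scc_of ` {i \<in> V. pa i = {}} = G.sccs_verts"
    unfolding G.sccs_verts_conv_scc_of V_G
  proof (intro antisym subsetI)
    fix S assume "S \<in> G.scc_of ` V"
    then obtain i where i: "i \<in> V" "S = G.scc_of i" by blast
    then obtain s where s: "source_of s i" using ex_source by blast
    then have root: "s \<in> V" "pa s = {}" by (induction) auto
    have "s \<rightarrow>\<^sup>*\<^bsub>G\<^esub> i" "i \<rightarrow>\<^sup>*\<^bsub>G\<^esub> s"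
      using source_reach[OF s] G.symmetric_reachable' by auto
    then have "G.scc_of i = G.scc_of s"
      by (auto simp: G.scc_of_def intro: G.reachable_trans)
    then show "S \<in> G.scc_of ` {i \<in> V. pa i = {}}" using i root by blast
  qed auto
  ultimately show ?thesis
    unfolding num_components_def G.card_sccs_verts[symmetric] by (metis card_image)
qed

end

section \<open>The normalizing constants\<close>

lemma set_integral_eq_nn_integral:
  fixes f :: "'a \<Rightarrow> real"
  assumes [measurable]: "f \<in> borel_measurable M" "A \<in> sets M"
    and nonneg: "\<And>x. f x \<ge> 0" and "c \<ge> 0"
    and c: "(\<integral>\<^sup>+x. ennreal (f x) * indicator A x \<partial>M) = ennreal c"
  shows "set_integrable M A f" "(LINT x:A|M. f x) = c"
proof -
  have "(\<integral>\<^sup>+x. ennreal (indicator A x *\<^sub>R f x) \<partial>M) = ennreal c"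
    unfolding c[symmetric] by (intro nn_integral_cong) (auto simp: indicator_def)
  then have "integrable M (\<lambda>x. indicator A x *\<^sub>R f x) \<and> integral\<^sup>L M (\<lambda>x. indicator A x *\<^sub>R f x) = c"
    using nonneg \<open>c \<ge> 0\<close> by (subst (asm) nn_integral_eq_integrable) auto
  then show "set_integrable M A f" "(LINT x:A|M. f x) = c"
    by (auto simp: set_integrable_def set_lebesgue_integral_def)
qed

context moral_orientation begin

text \<open>
  All denominators are values of \<open>g\<close> at subsets of cliques, which are cliques.  For
  \<open>g T = \<Gamma>(\<beta> - |\<alpha>\<^sub>T|)\<close> the bound on \<open>\<beta>\<close> excludes poles at cliques but not at other sets.
\<close>

lemma parents_quotient_eq_cliques_quotient:
  fixes g :: "'v set \<Rightarrow> real"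
  assumes po: "perfect_ordering G Cs" and "V \<noteq> {}"
    and g: "\<And>T. T \<in> cliques G \<Longrightarrow> g T \<noteq> 0"
  shows "(\<Prod>i\<in>V. g (closed_parents D i)) / (\<Prod>i\<in>V. g (pa i)) =
    (\<Prod>C\<in>max_cliques G. g C) /
    (g {} ^ num_components G * (\<Prod>S\<in>min_separators Cs. g S ^ sep_multiplicity Cs S))"
proof -
  have sub_clique: "T \<in> cliques G" if "T \<subseteq> C" "C \<in> cliques G" for T C
    using that by (auto simp: cliques_G)
  have "pa i \<in> cliques G" if "i \<in> V" for i
    using sub_clique[OF _ closed_parents_clique[OF that]] by (auto simp: closed_parents_def)
  then have pa_nz: "(\<Prod>i\<in>V. g (pa i)) \<noteq> 0" using g by simp
  have "sep Cs k \<in> cliques G" if "k < length Cs" for k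
  proof -
    have "Cs ! k \<in> max_cliques G" using po that by (auto simp: perfect_ordering_def)
    then show ?thesis using sub_clique[OF sep_subset] max_cliques_clique by blast
  qed
  then have sep_nz: "(\<Prod>k<length Cs. g (sep Cs k)) \<noteq> 0" using g by simp
  have "(\<Prod>k<length Cs. g (sep Cs k)) =
      g {} ^ num_components G * (\<Prod>S\<in>min_separators Cs. g S ^ sep_multiplicity Cs S)"
    by (simp only: prod_separators card_empty_separators[OF assms(1,2)] num_components_eq_sources)
  then show ?thesis
    using prod_parents_separators_cliques[OF po, of g] pa_nz sep_nz
    by (simp add: frac_eq_eq mult.commute)
qed

lemma G_induced_V: "G \<restriction> V = G"
  using induced_pverts[OF wellformed_mk_symmetric] by simp

lemma sum_closed_parents: "i \<in> V \<Longrightarrow> sum \<alpha> (closed_parents D i) = \<alpha> i + sum \<alpha> (pa i)"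
  using not_own_parent finite_subset[OF parents_subset finite_verts]
  by (simp add: closed_parents_def)

lemma dirichlet_const_parents:
  assumes \<alpha>: "\<And>i. i \<in> V \<Longrightarrow> \<alpha> i > 0" and \<beta>: "\<beta> > 0"
  shows "set_integrable (lebesgue_on_vectors V) (M_dom G) (dirichlet_kernel G \<alpha> \<beta>)" (is ?int)
    and "dirichlet_const G \<alpha> \<beta> =
      (\<Prod>i\<in>V. Gamma (sum \<alpha> (closed_parents D i) + \<beta>) / (Gamma (sum \<alpha> (pa i) + \<beta>) * Gamma (\<alpha> i)))"
    (is "?const = ?rhs")
proof -
  let ?c = "\<Prod>i\<in>V. Beta (\<alpha> i) (sum \<alpha> (pa i) + \<beta>)"
  have pos: "sum \<alpha> (pa i) + \<beta> > 0" for i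
    using \<alpha> \<beta> parents_subset by (intro add_nonneg_pos sum_nonneg) (auto intro: less_imp_le)
  then have "?c \<ge> 0" using \<alpha> by (intro prod_nonneg less_imp_le[OF Beta_real_pos]) auto
  moreover have "dirichlet_kernel G \<alpha> \<beta> x \<ge> 0" for x
    by (auto simp: dirichlet_kernel_def intro!: mult_nonneg_nonneg prod_nonneg)
  ultimately have int: "set_integrable (lebesgue_on_vectors V) (M_dom G) (dirichlet_kernel G \<alpha> \<beta>)"
      "(LINT x:M_dom G|lebesgue_on_vectors V. dirichlet_kernel G \<alpha> \<beta> x) = ?c"
    using nn_integral_dirichlet[OF ancestral_V \<alpha> \<beta>] dirichlet_kernel_measurable[OF order_refl, of \<alpha> \<beta>]
      M_dom_measurable[OF order_refl]
    by (simp_all add: G_induced_V set_integral_eq_nn_integral)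
  show ?int by (fact int)
  have "?const = inverse ?c" using int(2) by (simp add: dirichlet_const_def)
  also have "\<dots> = ?rhs"
    by (simp add: prod_inversef[symmetric] Beta_def sum_closed_parents add.assoc mult.commute
        cong: prod.cong)
  finally show "?const = ?rhs" .
qed

lemma inv_dirichlet_const_parents:
  assumes \<alpha>: "\<And>i. i \<in> V \<Longrightarrow> \<alpha> i > 0"
    and \<beta>: "\<And>i. i \<in> V \<Longrightarrow> \<beta> > sum \<alpha> (closed_parents D i)"
  shows "set_integrable (lebesgue_on_vectors V) (pos_orthant V) (inv_dirichlet_kernel G \<alpha> \<beta>)" (is ?int)
    and "inv_dirichlet_const G \<alpha> \<beta> =
      (\<Prod>i\<in>V. Gamma (\<beta> - sum \<alpha> (pa i)) / (Gamma (\<beta> - sum \<alpha> (closed_parents D i)) * Gamma (\<alpha> i)))"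
    (is "?const = ?rhs")
proof -
  let ?c = "\<Prod>i\<in>V. Beta (\<alpha> i) (\<beta> - sum \<alpha> (closed_parents D i))"
  have "?c \<ge> 0" using \<alpha> \<beta> by (intro prod_nonneg less_imp_le[OF Beta_real_pos]) auto
  moreover have "inv_dirichlet_kernel G \<alpha> \<beta> y \<ge> 0" for y
    by (auto simp: inv_dirichlet_kernel_def intro!: mult_nonneg_nonneg prod_nonneg)
  ultimately have int: "set_integrable (lebesgue_on_vectors V) (pos_orthant V) (inv_dirichlet_kernel G \<alpha> \<beta>)"
      "(LINT y:pos_orthant V|lebesgue_on_vectors V. inv_dirichlet_kernel G \<alpha> \<beta> y) = ?c"
    using nn_integral_inv_dirichlet[OF ancestral_V \<alpha> \<beta>] inv_dirichlet_kernel_measurable[OF order_refl, of \<alpha> \<beta>]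
      pos_orthant_measurable[of V]
    by (simp_all add: G_induced_V set_integral_eq_nn_integral)
  show ?int by (fact int)
  have "?const = inverse ?c" using int(2) by (simp add: inv_dirichlet_const_def)
  also have "\<dots> = ?rhs"
    by (simp add: prod_inversef[symmetric] Beta_def sum_closed_parents algebra_simps
        cong: prod.cong)
  finally show "?const = ?rhs" .
qed

lemma sum_clique_le_Max:
  fixes \<alpha> :: "'v \<Rightarrow> real"
  assumes "\<And>i. i \<in> V \<Longrightarrow> \<alpha> i > 0" "T \<in> cliques G"
  shows "sum \<alpha> T \<le> Max (sum \<alpha> ` max_cliques G)"
proof -
  obtain C where C: "C \<in> max_cliques G" "T \<subseteq> C"
    using assms(2) by (rule clique_in_max_clique[OF finite_cliques_G])
  then have "C \<subseteq> V" using max_cliques_clique[OF C(1)] by (auto simp: cliques_G)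
  then have "sum \<alpha> T \<le> sum \<alpha> C"
    using C(2) assms(1) finite_subset[OF _ finite_verts]
    by (intro sum_mono2) (auto intro: less_imp_le)
  moreover have "finite (max_cliques G)"
    using finite_cliques_G by (rule finite_subset[rotated]) (auto simp: max_cliques_def)
  ultimately show ?thesis using C(1) by (intro order_trans[OF _ Max_ge[of _ "sum \<alpha> C"]]) auto
qed

end

theorem theorem5p5:
  fixes D G :: "'v pair_pre_digraph" and \<alpha> :: "'v \<Rightarrow> real" and \<beta> :: real
  assumes "pair_graph G" and "pverts G \<noteq> {}"
    and "moral_dag D" and "mk_symmetric D = G"
    and "\<forall>i\<in>pverts G. \<alpha> i > 0"
  shows "(\<exists>Cs. perfect_ordering G Cs) \<and>
    (\<forall>Cs. perfect_ordering G Cs \<longrightarrow>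
      (\<beta> > 0 \<longrightarrow>
        set_integrable (lebesgue_on_vectors (pverts G)) (M_dom G) (dirichlet_kernel G \<alpha> \<beta>) \<and>
        dirichlet_const G \<alpha> \<beta> =
          (\<Prod>i\<in>pverts G. Gamma (sum \<alpha> (closed_parents D i) + \<beta>) /
             (Gamma (sum \<alpha> (parents D i) + \<beta>) * Gamma (\<alpha> i))) \<and>
        dirichlet_const G \<alpha> \<beta> =
          (\<Prod>C\<in>max_cliques G. Gamma (sum \<alpha> C + \<beta>)) /
          (Gamma \<beta> ^ num_components G * (\<Prod>i\<in>pverts G. Gamma (\<alpha> i)) *
           (\<Prod>S\<in>min_separators Cs. Gamma (sum \<alpha> S + \<beta>) ^ sep_multiplicity Cs S))) \<and>
      (\<beta> > Max (sum \<alpha> ` max_cliques G) \<longrightarrow>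
        set_integrable (lebesgue_on_vectors (pverts G)) (pos_orthant (pverts G))
          (inv_dirichlet_kernel G \<alpha> \<beta>) \<and>
        inv_dirichlet_const G \<alpha> \<beta> =
          (\<Prod>i\<in>pverts G. Gamma (\<beta> - sum \<alpha> (parents D i)) /
             (Gamma (\<beta> - sum \<alpha> (closed_parents D i)) * Gamma (\<alpha> i))) \<and>
        inv_dirichlet_const G \<alpha> \<beta> =
          (Gamma \<beta> ^ num_components G *
           (\<Prod>S\<in>min_separators Cs. Gamma (\<beta> - sum \<alpha> S) ^ sep_multiplicity Cs S)) /
          ((\<Prod>i\<in>pverts G. Gamma (\<alpha> i)) * (\<Prod>C\<in>max_cliques G. Gamma (\<beta> - sum \<alpha> C)))))"
proof -
  interpret M: moral_orientation D by unfold_locales fact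
  have G: "G = mk_symmetric (with_proj D)" using assms(4) by simp
  have V: "pverts G = pverts D" by (simp add: G)
  have V_ne: "pverts D \<noteq> {}" and \<alpha>: "\<And>i. i \<in> pverts D \<Longrightarrow> \<alpha> i > 0"
    using assms(2,5) by (auto simp: V)
  have sum_clique: "sum \<alpha> T \<ge> 0" if "T \<in> cliques G" for T
    using that \<alpha> by (intro sum_nonneg) (auto simp: G M.cliques_G intro: less_imp_le)
  show ?thesis
    unfolding V
  proof (intro conjI allI impI)
    show "\<exists>Cs. perfect_ordering G Cs"
      using M.ex_perfect_ordering[OF M.ancestral_V] by (simp add: M.G_induced_V G)
  next
    fix Cs assume po: "perfect_ordering G Cs" and \<beta>: "\<beta> > 0"
    let ?g = "\<lambda>T. Gamma (sum \<alpha> T + \<beta>)"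
    show "set_integrable (lebesgue_on_vectors (pverts D)) (M_dom G) (dirichlet_kernel G \<alpha> \<beta>)"
      unfolding G by (rule M.dirichlet_const_parents[OF \<alpha> \<beta>])
    show const: "dirichlet_const G \<alpha> \<beta> = (\<Prod>i\<in>pverts D. ?g (closed_parents D i) / (?g (parents D i) * Gamma (\<alpha> i)))"
      unfolding G by (rule M.dirichlet_const_parents[OF \<alpha> \<beta>])
    have "?g T \<noteq> 0" if "T \<in> cliques G" for T
      using sum_clique[OF that] \<beta> by (intro less_imp_neq[symmetric] Gamma_real_pos) auto
    then have graph: "(\<Prod>i\<in>pverts D. ?g (closed_parents D i)) / (\<Prod>i\<in>pverts D. ?g (parents D i)) =
        (\<Prod>C\<in>max_cliques G. ?g C) /
        (Gamma \<beta> ^ num_components G * (\<Prod>S\<in>min_separators Cs. ?g S ^ sep_multiplicity Cs S))"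
      using M.parents_quotient_eq_cliques_quotient[of Cs ?g] po V_ne by (simp add: G)
    have "dirichlet_const G \<alpha> \<beta> =
        (\<Prod>i\<in>pverts D. ?g (closed_parents D i)) / (\<Prod>i\<in>pverts D. ?g (parents D i)) / (\<Prod>i\<in>pverts D. Gamma (\<alpha> i))"
      by (simp add: const prod_dividef prod.distrib)
    then show "dirichlet_const G \<alpha> \<beta> = (\<Prod>C\<in>max_cliques G. ?g C) /
        (Gamma \<beta> ^ num_components G * (\<Prod>i\<in>pverts D. Gamma (\<alpha> i)) *
         (\<Prod>S\<in>min_separators Cs. ?g S ^ sep_multiplicity Cs S))"
      unfolding graph by (simp add: ac_simps)
  next
    fix Cs assume po: "perfect_ordering G Cs" and Max: "\<beta> > Max (sum \<alpha> ` max_cliques G)"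
    let ?h = "\<lambda>T. Gamma (\<beta> - sum \<alpha> T)"
    have \<beta>: "\<beta> > sum \<alpha> T" if "T \<in> cliques G" for T
      using M.sum_clique_le_Max[of \<alpha> T] \<alpha> that Max by (simp add: G)
    have \<beta>': "\<beta> > sum \<alpha> (closed_parents D i)" if "i \<in> pverts D" for i
      using \<beta> M.closed_parents_clique[OF that] by (simp add: G)
    show "set_integrable (lebesgue_on_vectors (pverts D)) (pos_orthant (pverts D)) (inv_dirichlet_kernel G \<alpha> \<beta>)"
      unfolding G by (rule M.inv_dirichlet_const_parents[OF \<alpha> \<beta>'])
    show const: "inv_dirichlet_const G \<alpha> \<beta> = (\<Prod>i\<in>pverts D. ?h (parents D i) / (?h (closed_parents D i) * Gamma (\<alpha> i)))"
      unfolding G by (rule M.inv_dirichlet_const_parents[OF \<alpha> \<beta>'])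
    have "?h T \<noteq> 0" if "T \<in> cliques G" for T
      using \<beta>[OF that] by (intro less_imp_neq[symmetric] Gamma_real_pos) auto
    then have graph: "(\<Prod>i\<in>pverts D. ?h (closed_parents D i)) / (\<Prod>i\<in>pverts D. ?h (parents D i)) =
        (\<Prod>C\<in>max_cliques G. ?h C) /
        (Gamma \<beta> ^ num_components G * (\<Prod>S\<in>min_separators Cs. ?h S ^ sep_multiplicity Cs S))"
      using M.parents_quotient_eq_cliques_quotient[of Cs ?h] po V_ne by (simp add: G)
    have "inv_dirichlet_const G \<alpha> \<beta> =
        inverse ((\<Prod>i\<in>pverts D. ?h (closed_parents D i)) / (\<Prod>i\<in>pverts D. ?h (parents D i))) / (\<Prod>i\<in>pverts D. Gamma (\<alpha> i))"
      by (simp add: const prod_dividef prod.distrib)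
    then show "inv_dirichlet_const G \<alpha> \<beta> =
        (Gamma \<beta> ^ num_components G * (\<Prod>S\<in>min_separators Cs. ?h S ^ sep_multiplicity Cs S)) /
        ((\<Prod>i\<in>pverts D. Gamma (\<alpha> i)) * (\<Prod>C\<in>max_cliques G. ?h C))"
      unfolding graph by (simp add: ac_simps)
  qed
qed

end
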